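(* Let $\delta\in(0,1)$ and $\tau\in(0,\frac12)$. Let $n,K,M$ be positive integers such that $$n\ge\frac{9\log(2/\delta)}{2\tau^2},\qquad K\ge\frac{\log(2/\delta)}{2(\frac12-\tau)^2},\qquad M=\left\lfloor\frac{2n\tau^2}{9\log(2/\delta)}\right\rfloor.$$ Let $X_1,\dots,X_n$ be i.i.d. in a measurable space $\mathcal{Z}$, and let $h:\mathcal{Z}\times\mathcal{Z}\to\mathbb{R}$ be a symmetric measurable kernel with $\mathbb{E}[h(X_1,X_2)^2]<\infty$ and $\theta(h)=\mathbb{E}[h(X_1,X_2)]$. Let $\widehat\theta_{\mathrm{MoIU}}(h)$ be the median-of-incomplete-U-statistics estimator with $K$ independent blocks, each consisting of $M$ pairs drawn with replacement (as defined in the context). Then, with probability at least $1-\delta$, $$\left|\widehat\theta_{\mathrm{MoIU}}(h)-\theta(h)\right|\le\sqrt{\frac{12\sigma_1^2(h)}{n\tau}+\frac{6\sigma_2^2(h)}{\tau n(n-1)}+\frac{27\sigma^2(h)\log(2/\delta)}{n\tau^3}}.$$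
   Context: Let $\Lambda_n=\{(i,j):1\le i<j\le n\}$. Let $\mathbf{J}_1,\dots,\mathbf{J}_K$ be mutually independent and independent of $(X_1,\dots,X_n)$, where each $\mathbf{J}_k$ is a sequence of $M$ pairs drawn independently and uniformly (with replacement) from $\Lambda_n$. Define $\widehat U_{M,\mathbf{J}_k}(h)=\frac1M\sum_{(i,j)\in\mathbf{J}_k}h(X_i,X_j)$ (counted with multiplicity) and $\widehat\theta_{\mathrm{MoIU}}(h)=\mathrm{med}\big(\widehat U_{M,\mathbf{J}_1}(h),\dots,\widehat U_{M,\mathbf{J}_K}(h)\big)$, the usual sample median. Variances: $\sigma_1^2(h)=\mathrm{Var}(\mathbb{E}[h(X_1,X_2)\mid X_1])$, $\sigma^2(h)=\mathrm{Var}(h(X_1,X_2))$, $\sigma_2^2(h)=\sigma^2(h)-2\sigma_1^2(h)$. *)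

theory Defs
  imports "HOL-Probability.Probability"
begin

definition index_pairs :: "nat \<Rightarrow> (nat \<times> nat) set" where
  "index_pairs n = {(i, j). 1 \<le> i \<and> i < j \<and> j \<le> n}"

text \<open>
  The library's independence predicate for two random variables forces both to take values in the
  same type; this one does not.
\<close>

definition indep_rvs ::
  "'w measure \<Rightarrow> 'a measure \<Rightarrow> ('w \<Rightarrow> 'a) \<Rightarrow> 'b measure \<Rightarrow> ('w \<Rightarrow> 'b) \<Rightarrow> bool" where
  "indep_rvs P A f B g \<longleftrightarrow>
    f \<in> measurable P A \<and> g \<in> measurable P B \<and>
    prob_space.indep_set P
      (sets (vimage_algebra (space P) f A)) (sets (vimage_algebra (space P) g B))"

text \<open>The average of the two middle order statistics is taken for lists of even length.\<close>

definition sample_median :: "real list \<Rightarrow> real" where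
  "sample_median xs =
    (let ys = sort xs; K = length xs in
     if odd K then ys ! (K div 2) else (ys ! (K div 2 - 1) + ys ! (K div 2)) / 2)"

text \<open>
  Throughout, \<open>X i\<close> for \<open>i \<in> {1..n}\<close> are the observations and \<open>J k m\<close> for \<open>m \<in> {1..M}\<close> is
  the \<open>m\<close>-th pair drawn for block \<open>k\<close>; summing over the draws \<open>m\<close> counts repeated pairs with
  multiplicity.
\<close>

definition incomplete_U ::
  "(nat \<Rightarrow> 'w \<Rightarrow> 'z) \<Rightarrow> ('z \<Rightarrow> 'z \<Rightarrow> real) \<Rightarrow> nat \<Rightarrow> (nat \<Rightarrow> 'w \<Rightarrow> nat \<times> nat) \<Rightarrow> 'w \<Rightarrow> real" where
  "incomplete_U X h M Jk \<omega> =
    (1 / real M) * (\<Sum>m = 1..M. case Jk m \<omega> of (i, j) \<Rightarrow> h (X i \<omega>) (X j \<omega>))"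

definition MoIU ::
  "(nat \<Rightarrow> 'w \<Rightarrow> 'z) \<Rightarrow> ('z \<Rightarrow> 'z \<Rightarrow> real) \<Rightarrow> nat \<Rightarrow> nat \<Rightarrow> (nat \<Rightarrow> nat \<Rightarrow> 'w \<Rightarrow> nat \<times> nat)
    \<Rightarrow> 'w \<Rightarrow> real" where
  "MoIU X h K M J \<omega> = sample_median (map (\<lambda>k. incomplete_U X h M (J k) \<omega>) [1..<K + 1])"

definition theta :: "'w measure \<Rightarrow> (nat \<Rightarrow> 'w \<Rightarrow> 'z) \<Rightarrow> ('z \<Rightarrow> 'z \<Rightarrow> real) \<Rightarrow> real" where
  "theta P X h = prob_space.expectation P (\<lambda>\<omega>. h (X 1 \<omega>) (X 2 \<omega>))"

definition sigma_sq :: "'w measure \<Rightarrow> (nat \<Rightarrow> 'w \<Rightarrow> 'z) \<Rightarrow> ('z \<Rightarrow> 'z \<Rightarrow> real) \<Rightarrow> real" where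
  "sigma_sq P X h = prob_space.variance P (\<lambda>\<omega>. h (X 1 \<omega>) (X 2 \<omega>))"

text \<open>
  Conditioning on \<open>X 1\<close> is conditioning on the sub-\<open>\<sigma>\<close>-algebra that \<open>X 1\<close> generates.
\<close>

definition sigma1_sq ::
  "'w measure \<Rightarrow> 'z measure \<Rightarrow> (nat \<Rightarrow> 'w \<Rightarrow> 'z) \<Rightarrow> ('z \<Rightarrow> 'z \<Rightarrow> real) \<Rightarrow> real" where
  "sigma1_sq P Z X h =
    prob_space.variance P
      (real_cond_exp P (vimage_algebra (space P) (X 1) Z) (\<lambda>\<omega>. h (X 1 \<omega>) (X 2 \<omega>)))"

definition sigma2_sq ::
  "'w measure \<Rightarrow> 'z measure \<Rightarrow> (nat \<Rightarrow> 'w \<Rightarrow> 'z) \<Rightarrow> ('z \<Rightarrow> 'z \<Rightarrow> real) \<Rightarrow> real" where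
  "sigma2_sq P Z X h = sigma_sq P X h - 2 * sigma1_sq P Z X h"

end

theory Submission
  imports Defs
begin

text \<open>
  Given the sample, call a block (a sequence of \<open>M\<close> pairs) bad if its mean is further than \<open>\<epsilon>\<close>
  from \<open>\<theta>\<close>, and let \<open>p\<close> be the fraction of bad blocks among all possible ones. If the median is off
  by more than \<open>\<epsilon>\<close>, at least half of the \<open>K\<close> independent uniform blocks are bad; while \<open>p \<le> \<tau>\<close>,
  Hoeffding's bound makes this an event of probability at most \<open>exp (- 2 K (1/2 - \<tau>)\<^sup>2) \<le> \<delta> / 2\<close>.
  As a function of the sample, \<open>p\<close> behaves like a U-statistic with a bounded kernel of degree \<open>2 M\<close>:
  it is an average over permutations of means of \<open>L = n div (2 M)\<close> independent \<open>[0, 1]\<close>-valued variables.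
  By the Chebyshev inequality its mean is at most \<open>\<tau> / 3\<close>, so that
  \<open>p \<ge> \<tau>\<close> has probability at most \<open>exp (- 2 L (2 \<tau> / 3)\<^sup>2) \<le> \<delta> / 2\<close>.
\<close>

section \<open>Uniform draws and sample medians\<close>

text \<open>The obstacle is that the \<open>K\<close> blocks share one sample, so they are
  independent only conditionally on it; the randomness of the draws and that of the sample are
  therefore treated separately, with \<open>p\<close> as the only link. As a function of the sample,
  a block mean is not a symmetric kernel with a fixed number of arguments: a block may repeat
  indices, so the number of observations it reads varies from block to block. That is why every
  block gets its own relabelling into a segment of length \<open>2 * M\<close>. The constants come
  from balancing. If three times the variance bound of a block mean is at most \<tau> \<epsilon>^2,
  a gap of 2 \<tau> / 3 remains between the mean of \<open>p\<close> and \<tau>. The exponent 8 L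
  \<tau>^2 / 9 then reaches ln (2 / \<delta>) once L is at least 9 ln (2 / \<delta>) / (8 \<tau>^2),
  and the prescribed \<open>M\<close> is small enough for this, yet large enough for the term
  \<sigma>^2 / M to be of order ln (2 / \<delta>) / (n \<tau>^2).\<close>

lemma exp_interp_le:
  fixes s x :: real
  assumes "0 \<le> x" "x \<le> 1"
  shows "exp (s * x) \<le> 1 + x * (exp s - 1)"
proof -
  have "convex_on UNIV (exp :: real \<Rightarrow> real)" by (rule exp_convex)
  from convex_onD[OF this, of x 0 s] assms show ?thesis
    by (simp add: algebra_simps)
qed

text \<open>For p at most 1 the left-hand side is the moment generating function of a Bernoulli
  variable of mean p, the worst case among [0, 1]-valued variables of that mean by the chord bound
  \<open>exp_interp_le\<close>.\<close>

lemma bernoulli_mgf_le: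
  fixes s p :: real
  assumes "0 \<le> s" "0 \<le> p"
  shows "1 + p * (exp s - 1) \<le> exp (s * p + s\<^sup>2 / 8)"
proof -
  have pos: "1 + p * (exp s - 1) > 0"
    using assms by (intro add_pos_nonneg mult_nonneg_nonneg) auto
  have "ln (1 + p * (exp s - 1)) \<le> s * p + s\<^sup>2 / 8"
    using Hoeffdings_lemma_aux[OF assms] by simp
  with pos show ?thesis
    by (metis exp_le_cancel_iff exp_ln)
qed

text \<open>An average over \<open>A \<rightarrow>\<^sub>E I\<close> is an expectation over
  independent uniform draws, one per element of \<open>A\<close>; their independence is the
  expansion of a product of sums.\<close>

lemma avg_PiE_prod:
  fixes F :: "'k \<Rightarrow> 'a \<Rightarrow> real"
  assumes "finite A" "finite I"
  shows "(\<Sum>j\<in>A \<rightarrow>\<^sub>E I. \<Prod>k\<in>A. F k (j k)) / real (card (A \<rightarrow>\<^sub>E I))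
    = (\<Prod>k\<in>A. (\<Sum>a\<in>I. F k a) / real (card I))"
proof -
  have "(\<Prod>k\<in>A. \<Sum>a\<in>I. F k a) = (\<Sum>j\<in>A \<rightarrow>\<^sub>E I. \<Prod>k\<in>A. F k (j k))"
    using assms by (intro prod_sum_PiE) auto
  then show ?thesis using assms by (simp add: prod_dividef card_PiE)
qed

lemma avg_PiE_two:
  fixes \<phi> \<psi> :: "'a \<Rightarrow> real" and A :: "'k set"
  assumes "finite A" "finite I" "I \<noteq> {}" "m \<in> A" "m' \<in> A" "m \<noteq> m'"
  shows "(\<Sum>j\<in>A \<rightarrow>\<^sub>E I. \<phi> (j m) * \<psi> (j m')) / real (card (A \<rightarrow>\<^sub>E I))
    = (\<Sum>a\<in>I. \<phi> a) / real (card I) * ((\<Sum>a\<in>I. \<psi> a) / real (card I))"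
proof -
  \<comment> \<open>The remaining coordinates carry the constant 1, whose average over the nonempty
    \<open>I\<close> is 1.\<close>
  define F where "F k a = (if k = m then \<phi> a else if k = m' then \<psi> a else 1)" for k a
  have A: "prod f A = f m * (f m' * prod f (A - {m, m'}))" for f :: "'k \<Rightarrow> real"
    using assms prod.remove[of A m f] prod.remove[of "A - {m}" m' f]
    by (simp add: Diff_insert2[symmetric])
  have c: "real (card I) \<noteq> 0" using assms by auto
  have "(\<Prod>k\<in>A. F k (j k)) = \<phi> (j m) * \<psi> (j m')" for j
    by (subst A) (use assms in \<open>simp add: F_def\<close>)
  moreover have "(\<Prod>k\<in>A. (\<Sum>a\<in>I. F k a) / real (card I))
    = (\<Sum>a\<in>I. \<phi> a) / real (card I) * ((\<Sum>a\<in>I. \<psi> a) / real (card I))"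
    by (subst A) (use assms c in \<open>simp add: F_def\<close>)
  ultimately show ?thesis using avg_PiE_prod[OF assms(1,2), of F] by simp
qed

lemma avg_PiE_one:
  fixes \<phi> :: "'a \<Rightarrow> real" and A :: "'k set"
  assumes "finite A" "finite I" "I \<noteq> {}" "m \<in> A"
  shows "(\<Sum>j\<in>A \<rightarrow>\<^sub>E I. \<phi> (j m)) / real (card (A \<rightarrow>\<^sub>E I)) = (\<Sum>a\<in>I. \<phi> a) / real (card I)"
proof -
  define F where "F k a = (if k = m then \<phi> a else 1)" for k a
  have A: "prod f A = f m * prod f (A - {m})" for f :: "'k \<Rightarrow> real"
    using assms by (intro prod.remove) auto
  have c: "real (card I) \<noteq> 0" using assms by auto
  have "(\<Prod>k\<in>A. F k (j k)) = \<phi> (j m)" for j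
    by (subst A) (use assms in \<open>simp add: F_def\<close>)
  moreover have "(\<Prod>k\<in>A. (\<Sum>a\<in>I. F k a) / real (card I)) = (\<Sum>a\<in>I. \<phi> a) / real (card I)"
    by (subst A) (use assms c in \<open>simp add: F_def\<close>)
  ultimately show ?thesis using avg_PiE_prod[OF assms(1,2), of F] by simp
qed

text \<open>Expanding the square, each diagonal term averages to the mean of \<open>G\<close>
  squared, and each off-diagonal term factorises into the square of the mean of \<open>G\<close>.
  Counting the off-diagonal terms as all of the |A|^2 pairs gives the inequality. With the sample
  fixed, this is the second moment of one block mean.\<close>

lemma avg_square_mean_draws_le:
  fixes G :: "'a \<Rightarrow> real"
  assumes "finite A" "A \<noteq> {}" "finite I" "I \<noteq> {}"
  shows "(\<Sum>j\<in>A \<rightarrow>\<^sub>E I. ((\<Sum>m\<in>A. G (j m)) / real (card A))\<^sup>2) / real (card (A \<rightarrow>\<^sub>E I))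
    \<le> (\<Sum>a\<in>I. (G a)\<^sup>2) / real (card I) / real (card A) + ((\<Sum>a\<in>I. G a) / real (card I))\<^sup>2"
proof -
  let ?S = "A \<rightarrow>\<^sub>E I" and ?a = "real (card A)"
  let ?v = "(\<Sum>a\<in>I. (G a)\<^sup>2) / real (card I)" and ?w = "((\<Sum>a\<in>I. G a) / real (card I))\<^sup>2"
  have a: "?a > 0" using assms by (simp add: card_gt_0_iff)
  have "(\<Sum>j\<in>?S. ((\<Sum>m\<in>A. G (j m)) / ?a)\<^sup>2) / real (card ?S)
     = (\<Sum>j\<in>?S. \<Sum>m\<in>A. \<Sum>m'\<in>A. G (j m) * G (j m')) / real (card ?S) / ?a\<^sup>2"
    by (simp add: power_divide sum_divide_distrib[symmetric] power2_eq_square sum_product)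
  also have "(\<Sum>j\<in>?S. \<Sum>m\<in>A. \<Sum>m'\<in>A. G (j m) * G (j m'))
     = (\<Sum>m\<in>A. \<Sum>m'\<in>A. \<Sum>j\<in>?S. G (j m) * G (j m'))"
    by (simp add: sum.swap[of _ A ?S])
  also have "\<dots> / real (card ?S) = (\<Sum>m\<in>A. \<Sum>m'\<in>A. (\<Sum>j\<in>?S. G (j m) * G (j m')) / real (card ?S))"
    by (simp add: sum_divide_distrib)
  also have "\<dots> = (\<Sum>m\<in>A. \<Sum>m'\<in>A. if m' = m then ?v else ?w)"
    using avg_PiE_two[OF assms(1,3,4), of _ _ G G] avg_PiE_one[OF assms(1,3,4), of _ "\<lambda>a. (G a)\<^sup>2"]
    by (intro sum.cong refl) (auto simp: power2_eq_square)
  also have "\<dots> \<le> (\<Sum>m\<in>A. \<Sum>m'\<in>A. (if m' = m then ?v else 0) + ?w)"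
    by (intro sum_mono) (auto intro!: divide_nonneg_nonneg sum_nonneg)
  also have "\<dots> = ?a * ?v + ?a\<^sup>2 * ?w"
    using assms by (simp add: sum.distrib power2_eq_square algebra_simps)
  also have "(?a * ?v + ?a\<^sup>2 * ?w) / ?a\<^sup>2 = ?v / ?a + ?w"
    using a by (simp add: field_simps power2_eq_square)
  finally show ?thesis using a by (simp add: divide_right_mono)
qed

text \<open>Chernoff's method in counting form: the indicator of at least half hits is dominated by
  a product over the draws of exponential weights centred at 1 / 2, and the average of such a
  product factorises.\<close>

lemma avg_half_hits_le:
  fixes t :: real
  assumes "finite A" "finite I" "I \<noteq> {}" "B \<subseteq> I"
    and p: "real (card B) / real (card I) \<le> t" and t: "t < 1 / 2"
  shows "real (card {j \<in> A \<rightarrow>\<^sub>E I. real (card A) \<le> 2 * real (card {k\<in>A. j k \<in> B})})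
      / real (card (A \<rightarrow>\<^sub>E I)) \<le> exp (- 2 * real (card A) * (1 / 2 - t)\<^sup>2)"
proof -
  let ?S = "A \<rightarrow>\<^sub>E I" and ?p = "real (card B) / real (card I)"
  \<comment> \<open>The minimiser of - s / 2 + s t + s^2 / 8, with minimum - 2 (1 / 2 - t)^2; it is
    positive because t < 1 / 2.\<close>
  define s where "s = 4 * (1 / 2 - t)"
  have s: "s \<ge> 0" using t by (simp add: s_def)
  have c: "real (card I) > 0" using assms by (simp add: card_gt_0_iff)
  have fS: "finite ?S" using assms by (intro finite_PiE) auto
  define F where "F = (\<lambda>(k :: 'a) (a :: 'b). exp (s * (of_bool (a \<in> B) - 1 / 2)))"
  have "real (card {j \<in> ?S. real (card A) \<le> 2 * real (card {k\<in>A. j k \<in> B})})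
      = (\<Sum>j\<in>?S. of_bool (real (card A) \<le> 2 * real (card {k\<in>A. j k \<in> B})))"
    using fS by (simp add: of_bool_def sum.If_cases Int_def)
  also have "\<dots> \<le> (\<Sum>j\<in>?S. \<Prod>k\<in>A. F k (j k))"
  proof (intro sum_mono)
    fix j
    have "(\<Prod>k\<in>A. F k (j k)) = exp (\<Sum>k\<in>A. s * (of_bool (j k \<in> B) - 1 / 2))"
      using assms by (simp add: F_def exp_sum)
    also have "(\<Sum>k\<in>A. s * (of_bool (j k \<in> B) - 1 / 2))
        = s * (real (card {k\<in>A. j k \<in> B}) - real (card A) / 2)"
      using assms by (simp add: sum_distrib_left[symmetric] sum_subtractf of_bool_def sum.If_cases Int_def)
    finally have *: "(\<Prod>k\<in>A. F k (j k)) = exp (s * (real (card {k\<in>A. j k \<in> B}) - real (card A) / 2))" .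
    have "real (card A) \<le> 2 * real (card {k\<in>A. j k \<in> B}) \<Longrightarrow>
       0 \<le> s * (real (card {k\<in>A. j k \<in> B}) - real (card A) / 2)"
      using s by (intro mult_nonneg_nonneg) auto
    then show "of_bool (real (card A) \<le> 2 * real (card {k\<in>A. j k \<in> B})) \<le> (\<Prod>k\<in>A. F k (j k))"
      unfolding * by (auto simp: of_bool_def)
  qed
  finally have "real (card {j \<in> ?S. real (card A) \<le> 2 * real (card {k\<in>A. j k \<in> B})}) / real (card ?S)
     \<le> (\<Sum>j\<in>?S. \<Prod>k\<in>A. F k (j k)) / real (card ?S)"
    by (intro divide_right_mono) auto
  also have "\<dots> = (\<Prod>k\<in>A. (\<Sum>a\<in>I. F k a) / real (card I))"
    using assms by (intro avg_PiE_prod) auto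
  also have "\<dots> \<le> (\<Prod>k\<in>A. exp (- 2 * (1 / 2 - t)\<^sup>2))"
  proof (intro prod_mono conjI)
    fix k
    show "0 \<le> (\<Sum>a\<in>I. F k a) / real (card I)" by (auto simp: F_def intro!: divide_nonneg_nonneg sum_nonneg)
    have "F k a = exp (- s / 2) * (1 + of_bool (a \<in> B) * (exp s - 1))" for a
      by (auto simp: F_def exp_add[symmetric] algebra_simps)
    then have "(\<Sum>a\<in>I. F k a) = exp (- s / 2) * (real (card I) + real (card B) * (exp s - 1))"
      using assms finite_subset[OF assms(4,2)]
      by (simp add: sum_distrib_left[symmetric] sum_distrib_right[symmetric] sum.distrib of_bool_def sum.If_cases Int_absorb1)
    then have "(\<Sum>a\<in>I. F k a) / real (card I) = exp (- s / 2) * (1 + ?p * (exp s - 1))"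
      using c by (simp add: field_simps)
    also have "\<dots> \<le> exp (- s / 2) * exp (s * ?p + s\<^sup>2 / 8)"
      using s by (intro mult_left_mono bernoulli_mgf_le) auto
    also have "\<dots> \<le> exp (- s / 2) * exp (s * t + s\<^sup>2 / 8)"
      using s p by (intro mult_left_mono) (auto intro: mult_left_mono simp del: times_divide_eq_right)
    also have "\<dots> = exp (- 2 * (1 / 2 - t)\<^sup>2)"
    proof -
      have "- s / 2 + (s * t + s\<^sup>2 / 8) = - 2 * (1 / 2 - t)\<^sup>2"
        unfolding s_def power2_eq_square by (simp add: field_simps)
      then show ?thesis by (metis exp_add)
    qed
    finally show "(\<Sum>a\<in>I. F k a) / real (card I) \<le> exp (- 2 * (1 / 2 - t)\<^sup>2)" .
  qed
  also have "\<dots> = exp (- 2 * real (card A) * (1 / 2 - t)\<^sup>2)"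
    by (simp only: prod_constant exp_of_nat_mult[symmetric]) (simp only: mult_ac)
  finally show ?thesis .
qed

section \<open>Order statistics and the sample median\<close>

lemma card_filter_nth_sort:
  "card {i. i < length xs \<and> Q (sort xs ! i)} = card {i. i < length xs \<and> Q (xs ! i)}"
proof -
  have "length (filter Q (sort xs)) = length (filter Q xs)"
    by (metis filter_sort length_sort)
  then show ?thesis by (simp add: length_filter_conv_card)
qed

lemma card_ge_of_upper:
  assumes "\<And>i. a \<le> i \<Longrightarrow> i < b \<Longrightarrow> Q i"
  shows "b - a \<le> card {i. i < b \<and> Q i}"
proof -
  have "card {a..<b} \<le> card {i. i < b \<and> Q i}" using assms by (intro card_mono) auto
  then show ?thesis by simp
qed

lemma card_ge_of_lower:
  assumes "\<And>i. i < a \<Longrightarrow> Q i" "a \<le> b"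
  shows "a \<le> card {i. i < b \<and> Q i}"
proof -
  have "card {..<a} \<le> card {i. i < b \<and> Q i}" using assms by (intro card_mono) auto
  then show ?thesis by simp
qed

text \<open>Position \<open>K div 2\<close> is the upper middle one for even length and the middle
  one for odd length. Its value bounds the median from above in both cases, so it and all later
  values exceed \<open>c\<close>.\<close>

lemma sample_median_gt:
  assumes "sample_median xs > c" "xs \<noteq> []"
  shows "length xs \<le> 2 * card {i. i < length xs \<and> xs ! i > c}"
proof -
  let ?ys = "sort xs" and ?K = "length xs"
  have K: "?K > 0" using assms by simp
  have m: "?ys ! i \<le> ?ys ! j" if "i \<le> j" "j < ?K" for i j
    using that by (intro sorted_nth_mono) auto
  have "?ys ! (?K div 2) > c"
    using assms(1) K m[of "?K div 2 - 1" "?K div 2"]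
    by (auto simp: sample_median_def Let_def split: if_splits)
  then have "?K - ?K div 2 \<le> card {i. i < ?K \<and> ?ys ! i > c}"
    using m by (intro card_ge_of_upper) (meson less_le_trans)
  then show ?thesis unfolding card_filter_nth_sort by linarith
qed

lemma sample_median_lt:
  assumes "sample_median xs < c" "xs \<noteq> []"
  shows "length xs \<le> 2 * card {i. i < length xs \<and> xs ! i < c}"
proof -
  let ?ys = "sort xs" and ?K = "length xs"
  have K: "?K > 0" using assms by simp
  have m: "?ys ! i \<le> ?ys ! j" if "i \<le> j" "j < ?K" for i j
    using that by (intro sorted_nth_mono) auto
  \<comment> \<open>The lower middle position: \<open>?K div 2\<close> for odd length and
    \<open>?K div 2 - 1\<close> for even length.\<close>
  have "?ys ! ((?K + 1) div 2 - 1) < c"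
  proof (cases "odd ?K")
    case True
    then have "(?K + 1) div 2 - 1 = ?K div 2" by presburger
    with True assms(1) show ?thesis by (simp add: sample_median_def Let_def)
  next
    case False
    then have "(?K + 1) div 2 - 1 = ?K div 2 - 1" by presburger
    with False assms(1) K m[of "?K div 2 - 1" "?K div 2"] show ?thesis
      by (auto simp: sample_median_def Let_def)
  qed
  moreover have "?ys ! i \<le> ?ys ! ((?K + 1) div 2 - 1)" if "i < (?K + 1) div 2" for i
    using that K by (intro m) linarith+
  ultimately have "(?K + 1) div 2 \<le> card {i. i < ?K \<and> ?ys ! i < c}"
    using K by (intro card_ge_of_lower) (meson le_less_trans, linarith)
  then show ?thesis using card_filter_nth_sort[of xs "\<lambda>y. y < c"] by linarith
qed

lemma sample_median_deviation:
  assumes "\<bar>sample_median xs - c\<bar> > e" "xs \<noteq> []"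
  shows "length xs \<le> 2 * card {i. i < length xs \<and> \<bar>xs ! i - c\<bar> > e}"
proof -
  consider "sample_median xs > c + e" | "sample_median xs < c - e" using assms by linarith
  then show ?thesis
  proof cases
    case 1
    note sample_median_gt[OF this assms(2)]
    also have "card {i. i < length xs \<and> xs ! i > c + e} \<le> card {i. i < length xs \<and> \<bar>xs ! i - c\<bar> > e}"
      by (intro card_mono) auto
    finally show ?thesis by simp
  next
    case 2
    note sample_median_lt[OF this assms(2)]
    also have "card {i. i < length xs \<and> xs ! i < c - e} \<le> card {i. i < length xs \<and> \<bar>xs ! i - c\<bar> > e}"
      by (intro card_mono) auto
    finally show ?thesis by simp
  qed
qed

text \<open>Measurability of order statistics rests on this: their sublevel sets are described by a
  count, hence by a finite sum of indicators.\<close>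

lemma sort_nth_le_iff:
  fixes xs :: "real list"
  assumes "i < length xs"
  shows "sort xs ! i \<le> a \<longleftrightarrow> i < card {k. k < length xs \<and> xs ! k \<le> a}"
proof
  assume "sort xs ! i \<le> a"
  then have "Suc i \<le> card {k. k < length xs \<and> sort xs ! k \<le> a}"
    using assms by (intro card_ge_of_lower)
      (auto intro: order_trans[OF sorted_nth_mono[of "sort xs" _ i]])
  then show "i < card {k. k < length xs \<and> xs ! k \<le> a}"
    using card_filter_nth_sort[of xs "\<lambda>y. y \<le> a"] by simp
next
  assume *: "i < card {k. k < length xs \<and> xs ! k \<le> a}"
  show "sort xs ! i \<le> a"
  proof (rule ccontr)
    assume gt: "\<not> sort xs ! i \<le> a"
    have "{k. k < length xs \<and> sort xs ! k \<le> a} \<subseteq> {..<i}"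
    proof
      fix k assume k: "k \<in> {k. k < length xs \<and> sort xs ! k \<le> a}"
      then have "\<not> i \<le> k" using gt sorted_nth_mono[of "sort xs" i k] by auto
      then show "k \<in> {..<i}" by simp
    qed
    then have "card {k. k < length xs \<and> sort xs ! k \<le> a} \<le> i"
      by (metis card_lessThan card_mono finite_lessThan)
    with * show False using card_filter_nth_sort[of xs "\<lambda>y. y \<le> a"] by simp
  qed
qed

lemma borel_measurable_sort_nth:
  fixes f :: "'b \<Rightarrow> 'a \<Rightarrow> real"
  assumes f: "\<And>k. k \<in> set ks \<Longrightarrow> f k \<in> borel_measurable N" and i: "i < length ks"
  shows "(\<lambda>x. sort (map (\<lambda>k. f k x) ks) ! i) \<in> borel_measurable N"
  unfolding borel_measurable_iff_le
proof
  fix a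
  have [measurable]: "f (ks ! k) \<in> borel_measurable N" if "k < length ks" for k using f that by simp
  let ?c = "\<lambda>x. \<Sum>k<length ks. of_bool (f (ks ! k) x \<le> a) :: real"
  have c: "card {k. k < length ks \<and> map (\<lambda>k. f k x) ks ! k \<le> a} = ?c x" for x
  proof -
    have "{k. k < length ks \<and> map (\<lambda>k. f k x) ks ! k \<le> a} = {..<length ks} \<inter> {k. f (ks ! k) x \<le> a}"
      by auto
    then show ?thesis by (simp add: of_bool_def sum.If_cases)
  qed
  have "?c \<in> borel_measurable N"
    by (intro borel_measurable_sum) (auto simp: of_bool_def)
  then have "{x \<in> space N. real i < ?c x} \<in> sets N" by measurable
  moreover have "{x \<in> space N. sort (map (\<lambda>k. f k x) ks) ! i \<le> a} = {x \<in> space N. real i < ?c x}"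
    using i by (simp add: sort_nth_le_iff c[symmetric] del: nth_map)
  ultimately show "{x \<in> space N. sort (map (\<lambda>k. f k x) ks) ! i \<le> a} \<in> sets N" by simp
qed

lemma borel_measurable_sample_median:
  fixes f :: "'b \<Rightarrow> 'a \<Rightarrow> real"
  assumes "\<And>k. k \<in> set ks \<Longrightarrow> f k \<in> borel_measurable N" "ks \<noteq> []"
  shows "(\<lambda>x. sample_median (map (\<lambda>k. f k x) ks)) \<in> borel_measurable N"
proof -
  have "length ks > 0" using assms by simp
  then have "length ks div 2 - 1 < length ks" "length ks div 2 < length ks" by linarith+
  then have "(\<lambda>x. sort (map (\<lambda>k. f k x) ks) ! (length ks div 2 - 1)) \<in> borel_measurable N"
    "(\<lambda>x. sort (map (\<lambda>k. f k x) ks) ! (length ks div 2)) \<in> borel_measurable N"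
    by (simp_all only: borel_measurable_sort_nth[OF assms(1)])
  then show ?thesis
    by (cases "odd (length ks)") (simp_all add: sample_median_def Let_def)
qed

section \<open>Exchangeability and the Hoeffding bound for symmetric averages\<close>

locale iid_sample = prob_space P for P :: "'w measure" +
  fixes Z :: "'z measure" and X :: "nat \<Rightarrow> 'w \<Rightarrow> 'z" and n :: nat
  assumes X_indep: "indep_vars (\<lambda>_. Z) X {1..n}"
    and X_ident: "\<And>i. i \<in> {1..n} \<Longrightarrow> distr P Z (X i) = distr P Z (X 1)"
    and n_pos: "0 < n"
begin

lemma X_measurable [measurable]: "i \<in> {1..n} \<Longrightarrow> X i \<in> measurable P Z"
  using X_indep unfolding indep_vars_def by blast

lemma X_space: "i \<in> {1..n} \<Longrightarrow> \<omega> \<in> space P \<Longrightarrow> X i \<omega> \<in> space Z"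
  using X_measurable by (rule measurable_space)

lemma measurable_select:
  assumes "\<pi> ` I \<subseteq> {1..n}"
  shows "(\<lambda>\<omega>. \<lambda>i\<in>I. X (\<pi> i) \<omega>) \<in> measurable P (\<Pi>\<^sub>M i\<in>I. Z)"
  using assms by (intro measurable_restrict X_measurable) auto

text \<open>The joint law of the sample is a power of the law of \<open>X 1\<close>, and selecting
  coordinates along an injection maps a power to a power. As the result does not involve
  \<open>\<pi>\<close>, any two injective selections have the same law.\<close>

lemma distr_select:
  assumes "\<pi> ` I \<subseteq> {1..n}" "inj_on \<pi> I"
  shows "distr P (\<Pi>\<^sub>M i\<in>I. Z) (\<lambda>\<omega>. \<lambda>i\<in>I. X (\<pi> i) \<omega>) = (\<Pi>\<^sub>M i\<in>I. distr P Z (X 1))"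
proof -
  let ?\<mu> = "distr P Z (X 1)" and ?N = "{1..n}"
  have one: "1 \<in> ?N" using n_pos by simp
  interpret \<mu>: prob_space ?\<mu> by (intro prob_space_distr X_measurable one)
  have sets: "sets (\<Pi>\<^sub>M i\<in>I. Z) = sets (\<Pi>\<^sub>M i\<in>I. ?\<mu>)" "sets (\<Pi>\<^sub>M i\<in>?N. Z) = sets (\<Pi>\<^sub>M i\<in>?N. ?\<mu>)"
    by (intro sets_PiM_cong refl; simp)+
  have marg: "(\<Pi>\<^sub>M i\<in>?N. distr P Z (X i)) = (\<Pi>\<^sub>M i\<in>?N. ?\<mu>)"
    by (intro PiM_cong refl X_ident)
  have full: "distr P (\<Pi>\<^sub>M i\<in>?N. Z) (\<lambda>\<omega>. \<lambda>i\<in>?N. X i \<omega>) = (\<Pi>\<^sub>M i\<in>?N. ?\<mu>)"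
    using indep_vars_iff_distr_eq_PiM'[where I = ?N and M' = "\<lambda>_. Z" and X = X] X_indep X_measurable one
    unfolding marg by blast
  have sel: "(\<lambda>x. \<lambda>i\<in>I. x (\<pi> i)) \<in> measurable (\<Pi>\<^sub>M i\<in>?N. Z) (\<Pi>\<^sub>M i\<in>I. Z)"
    using assms by (intro measurable_restrict measurable_component_singleton) auto
  have "distr P (\<Pi>\<^sub>M i\<in>I. Z) (\<lambda>\<omega>. \<lambda>i\<in>I. X (\<pi> i) \<omega>)
    = distr P (\<Pi>\<^sub>M i\<in>I. Z) ((\<lambda>x. \<lambda>i\<in>I. x (\<pi> i)) \<circ> (\<lambda>\<omega>. \<lambda>i\<in>?N. X i \<omega>))"
    using assms by (intro distr_cong refl) (auto simp: fun_eq_iff restrict_def)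
  also have "\<dots> = distr (distr P (\<Pi>\<^sub>M i\<in>?N. Z) (\<lambda>\<omega>. \<lambda>i\<in>?N. X i \<omega>)) (\<Pi>\<^sub>M i\<in>I. Z) (\<lambda>x. \<lambda>i\<in>I. x (\<pi> i))"
    by (intro distr_distr[symmetric] sel measurable_select) auto
  also have "\<dots> = distr (\<Pi>\<^sub>M i\<in>?N. ?\<mu>) (\<Pi>\<^sub>M i\<in>I. ?\<mu>) (\<lambda>x. \<lambda>i\<in>I. x (\<pi> i))"
    unfolding full by (intro distr_cong refl sets)
  also have "\<dots> = (\<Pi>\<^sub>M i\<in>I. ?\<mu>)"
    using assms by (intro distr_PiM_reindex \<mu>.prob_space_axioms) auto
  finally show ?thesis .
qed

lemma exchangeable:
  fixes F :: "(nat \<Rightarrow> 'z) \<Rightarrow> real"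
  assumes "\<pi> ` I \<subseteq> {1..n}" "inj_on \<pi> I" "\<rho> ` I \<subseteq> {1..n}" "inj_on \<rho> I"
    and F: "F \<in> borel_measurable (\<Pi>\<^sub>M i\<in>I. Z)"
  shows "expectation (\<lambda>\<omega>. F (\<lambda>i\<in>I. X (\<pi> i) \<omega>)) = expectation (\<lambda>\<omega>. F (\<lambda>i\<in>I. X (\<rho> i) \<omega>))"
proof -
  have "expectation (\<lambda>\<omega>. F (\<lambda>i\<in>I. X (\<tau> i) \<omega>)) = integral\<^sup>L (\<Pi>\<^sub>M i\<in>I. distr P Z (X 1)) F"
    if "\<tau> ` I \<subseteq> {1..n}" "inj_on \<tau> I" for \<tau>
    unfolding distr_select[OF that, symmetric]
    by (rule integral_distr[symmetric, OF measurable_select[OF that(1)] F])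
  with assms show ?thesis by simp
qed

lemma exchangeable_integrable:
  fixes F :: "(nat \<Rightarrow> 'z) \<Rightarrow> real"
  assumes "\<pi> ` I \<subseteq> {1..n}" "inj_on \<pi> I" "\<rho> ` I \<subseteq> {1..n}" "inj_on \<rho> I"
    and F: "F \<in> borel_measurable (\<Pi>\<^sub>M i\<in>I. Z)"
  shows "integrable P (\<lambda>\<omega>. F (\<lambda>i\<in>I. X (\<pi> i) \<omega>)) \<longleftrightarrow> integrable P (\<lambda>\<omega>. F (\<lambda>i\<in>I. X (\<rho> i) \<omega>))"
proof -
  have "integrable P (\<lambda>\<omega>. F (\<lambda>i\<in>I. X (\<tau> i) \<omega>)) \<longleftrightarrow> integrable (\<Pi>\<^sub>M i\<in>I. distr P Z (X 1)) F"
    if "\<tau> ` I \<subseteq> {1..n}" "inj_on \<tau> I" for \<tau>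
    unfolding distr_select[OF that, symmetric]
    by (rule integrable_distr_eq[symmetric, OF measurable_select[OF that(1)] F])
  with assms show ?thesis by simp
qed

end

section \<open>Exponential moments, convexity and permutations\<close>

lemma (in prob_space) mgf_le_Hoeffding:
  fixes G :: "'a \<Rightarrow> real"
  assumes [measurable]: "G \<in> borel_measurable M" and G: "\<And>x. x \<in> space M \<Longrightarrow> 0 \<le> G x \<and> G x \<le> 1"
    and s: "0 \<le> s"
  shows "expectation (\<lambda>x. exp (s * G x)) \<le> exp (s * expectation G + s\<^sup>2 / 8)"
proof -
  have iG: "integrable M G"
    using G by (intro integrable_const_bound[of _ 1]) auto
  have iE: "integrable M (\<lambda>x. exp (s * G x))"
    using G s by (intro integrable_const_bound[of _ "exp s"]) (auto intro!: mult_left_le)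
  have "expectation (\<lambda>x. exp (s * G x)) \<le> expectation (\<lambda>x. 1 + G x * (exp s - 1))"
    using G iG iE by (intro integral_mono exp_interp_le) auto
  also have "\<dots> = 1 + expectation G * (exp s - 1)"
    using iG by (simp add: prob_space)
  also have "\<dots> \<le> exp (s * expectation G + s\<^sup>2 / 8)"
    using G s by (intro bernoulli_mgf_le integral_nonneg_AE) auto
  finally show ?thesis .
qed

lemma exp_avg_le:
  fixes y :: "'a \<Rightarrow> real"
  assumes "finite A" "A \<noteq> {}"
  shows "exp ((\<Sum>a\<in>A. y a) / real (card A)) \<le> (\<Sum>a\<in>A. exp (y a)) / real (card A)"
proof -
  have "convex_on UNIV (exp :: real \<Rightarrow> real)" by (rule exp_convex)
  from convex_on_sum[OF assms this, of "\<lambda>_. 1 / real (card A)" y] assms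
  show ?thesis by (simp add: sum_divide_distrib)
qed

text \<open>A bijection from \<open>A\<close> onto a subset of \<open>B\<close> and one between the
  complements in \<open>C\<close>, which have equal cardinality, are glued into one
  permutation.\<close>

lemma permutes_extending_inj:
  assumes "finite C" "A \<subseteq> C" "B \<subseteq> C" "card A \<le> card B"
  obtains \<sigma> where "\<sigma> permutes C" "\<sigma> ` A \<subseteq> B"
proof -
  have fin: "finite A" "finite B" using assms finite_subset by auto
  obtain D where D: "D \<subseteq> B" "card D = card A" using assms(4) fin by (metis obtain_subset_with_card_n)
  have fD: "finite D" using D fin finite_subset by auto
  obtain f where f: "bij_betw f A D" using D fin fD by (metis finite_same_card_bij)
  have "card (C - A) = card (C - D)" using D assms fin fD by (simp add: card_Diff_subset)
  then obtain g where g: "bij_betw g (C - A) (C - D)"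
    using assms(1) by (meson finite_Diff finite_same_card_bij)
  define \<sigma> where "\<sigma> i = (if i \<in> A then f i else if i \<in> C then g i else i)" for i
  have "bij_betw \<sigma> A D" using f by (rule bij_betw_cong[THEN iffD1, rotated]) (auto simp: \<sigma>_def)
  moreover have "bij_betw \<sigma> (C - A) (C - D)"
    using g by (rule bij_betw_cong[THEN iffD1, rotated]) (auto simp: \<sigma>_def)
  ultimately have "bij_betw \<sigma> (A \<union> (C - A)) (D \<union> (C - D))" by (rule bij_betw_combine) auto
  moreover have "A \<union> (C - A) = C" "D \<union> (C - D) = C" using assms D by auto
  ultimately have "\<sigma> permutes C"
    using assms by (intro bij_imp_permutes) (auto simp: \<sigma>_def)
  moreover have "\<sigma> ` A \<subseteq> B" using D f by (auto simp: \<sigma>_def bij_betw_def)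
  ultimately show ?thesis by (rule that)
qed

context iid_sample begin

text \<open>
  Each \<open>f j\<close> depends on at most \<open>D\<close> coordinates, which a permutation \<open>\<sigma> j l\<close> moves into the \<open>l\<close>-th of \<open>L\<close>
  disjoint blocks of length \<open>D\<close>. Averaging over all permutations of the sample undoes this
  relabelling, so Jensen's inequality reduces the claim to independent summands.
\<close>

lemma avg_mgf_le:
  fixes f :: "'j \<Rightarrow> (nat \<Rightarrow> 'z) \<Rightarrow> real"
  assumes S: "finite S" "S \<noteq> {}"
    and f01: "\<And>j x. j \<in> S \<Longrightarrow> 0 \<le> f j x \<and> f j x \<le> 1"
    and meas: "\<And>j. j \<in> S \<Longrightarrow> f j \<in> borel_measurable (\<Pi>\<^sub>M i\<in>U j. Z)"
    and dep: "\<And>j x. j \<in> S \<Longrightarrow> f j (restrict x (U j)) = f j x"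
    and U: "\<And>j. j \<in> S \<Longrightarrow> U j \<subseteq> {1..n}" "\<And>j. j \<in> S \<Longrightarrow> card (U j) \<le> D"
    and L: "0 < L" "L * D \<le> n" and s: "0 \<le> s"
    and inv: "\<And>\<pi> x. \<pi> permutes {1..n} \<Longrightarrow> x ` {1..n} \<subseteq> space Z \<Longrightarrow>
      (\<Sum>j\<in>S. f j (\<lambda>i. x (\<pi> i))) = (\<Sum>j\<in>S. f j x)"
  defines "p \<equiv> \<lambda>x. (\<Sum>j\<in>S. f j x) / real (card S)"
  shows "expectation (\<lambda>\<omega>. exp (s * p (\<lambda>i. X i \<omega>)))
    \<le> exp (s * expectation (\<lambda>\<omega>. p (\<lambda>i. X i \<omega>)) + s\<^sup>2 / (8 * real L))"
proof -
  let ?N = "{1..n}"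
  let ?Xv = "\<lambda>\<omega> i. X i \<omega>"
  define Perm where "Perm = {\<pi>. \<pi> permutes ?N}"
  \<comment> \<open>The segments start at \<open>l * D + 1\<close> because the sample is indexed
    from 1; \<open>L * D \<le> n\<close> keeps all of them inside it.\<close>
  define B where "B l = {l * D + 1 .. l * D + D}" for l
  have fPerm: "finite Perm" "Perm \<noteq> {}" unfolding Perm_def using finite_permutations permutes_id by blast+
  have cS: "real (card S) > 0" using S by (simp add: card_gt_0_iff)
  have BN: "B l \<subseteq> ?N" if "l < L" for l
  proof -
    have "(l + 1) * D \<le> L * D" using that by (intro mult_right_mono) auto
    with L(2) show ?thesis by (auto simp: B_def)
  qed
  have Bdisj: "disjoint_family_on B {..<L}"
  proof -
    have "B l \<inter> B l' = {}" if "l < l'" for l l'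
    proof -
      have "(l + 1) * D \<le> l' * D" using that by (intro mult_right_mono) auto
      then show ?thesis by (auto simp: B_def)
    qed
    then show ?thesis unfolding disjoint_family_on_def by (metis inf_commute linorder_neqE_nat)
  qed
  have "\<exists>\<sigma>. \<sigma> permutes ?N \<and> \<sigma> ` U j \<subseteq> B l" if "j \<in> S" "l < L" for j l
  proof -
    have "card (U j) \<le> card (B l)" using U(2)[OF that(1)] by (simp add: B_def)
    from permutes_extending_inj[OF _ U(1)[OF that(1)] BN[OF that(2)] this] show ?thesis
      by (metis finite_atLeastAtMost)
  qed
  then obtain \<sigma> where \<sigma>: "\<And>j l. j \<in> S \<Longrightarrow> l < L \<Longrightarrow> \<sigma> j l permutes ?N"
    "\<And>j l. j \<in> S \<Longrightarrow> l < L \<Longrightarrow> \<sigma> j l ` U j \<subseteq> B l"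
    by metis
  \<comment> \<open>Every summand of \<open>G l\<close> reads only coordinates in
    \<open>B l\<close>, so the \<open>G l\<close> are independent for distinct \<open>l\<close>,
    although each of them averages over all of \<open>S\<close>.\<close>
  define G where "G l x = (\<Sum>j\<in>S. f j (\<lambda>i. x (\<sigma> j l i))) / real (card S)" for l x
  have G01: "0 \<le> G l x \<and> G l x \<le> 1" for l x
  proof -
    have "(\<Sum>j\<in>S. f j (\<lambda>i. x (\<sigma> j l i))) \<le> (\<Sum>j\<in>S. 1)" using f01 by (intro sum_mono) auto
    then show ?thesis using cS f01 by (auto simp: G_def intro!: divide_nonneg_nonneg sum_nonneg)
  qed
  have fU: "f j (\<lambda>i. x (\<sigma> j l i)) = f j (\<lambda>i\<in>U j. x (\<sigma> j l i))" if "j \<in> S" for x j l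
    using dep[OF that] by metis
  have G_restrict: "G l (restrict x I) = G l x" if "l < L" "B l \<subseteq> I" for l x I
  proof -
    have "(\<lambda>i\<in>U j. restrict x I (\<sigma> j l i)) = (\<lambda>i\<in>U j. x (\<sigma> j l i))" if "j \<in> S" for j
      using \<sigma>(2)[OF that \<open>l < L\<close>] \<open>B l \<subseteq> I\<close> by (auto simp: fun_eq_iff restrict_def)
    then have "f j (\<lambda>i. restrict x I (\<sigma> j l i)) = f j (\<lambda>i. x (\<sigma> j l i))" if "j \<in> S" for j
      using that by (subst (1 2) fU) auto
    then show ?thesis unfolding G_def by (simp cong: sum.cong)
  qed
  have G_meas: "G l \<in> borel_measurable (\<Pi>\<^sub>M i\<in>I. Z)" if "l < L" "B l \<subseteq> I" for l I
  proof -
    have "(\<lambda>x. f j (\<lambda>i\<in>U j. x (\<sigma> j l i))) \<in> borel_measurable (\<Pi>\<^sub>M i\<in>I. Z)" if "j \<in> S" for j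
      using \<sigma>(2)[OF that \<open>l < L\<close>] \<open>B l \<subseteq> I\<close>
      by (intro measurable_compose[OF _ meas[OF that]] measurable_restrict measurable_component_singleton) auto
    then have "(\<lambda>x. f j (\<lambda>i. x (\<sigma> j l i))) \<in> borel_measurable (\<Pi>\<^sub>M i\<in>I. Z)" if "j \<in> S" for j
      using that by (subst fU) auto
    then show ?thesis unfolding G_def
      by (intro borel_measurable_divide borel_measurable_sum borel_measurable_const)
  qed
  have indep: "indep_vars (\<lambda>_. borel) (\<lambda>l \<omega>. G l (?Xv \<omega>)) {..<L}"
  proof -
    have "indep_vars (\<lambda>l. \<Pi>\<^sub>M i\<in>B l. Z) (\<lambda>l \<omega>. restrict (?Xv \<omega>) (B l)) {..<L}"
      using BN Bdisj by (intro indep_vars_restrict[OF X_indep]) auto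
    then have "indep_vars (\<lambda>_. borel) (\<lambda>l \<omega>. G l (restrict (?Xv \<omega>) (B l))) {..<L}"
      by (rule indep_vars_compose2) (auto intro: G_meas)
    moreover have "G l (restrict (?Xv \<omega>) (B l)) = G l (?Xv \<omega>)" if "l < L" for l \<omega>
      using that by (intro G_restrict) auto
    ultimately show ?thesis by (subst indep_vars_cong) auto
  qed
  have f_int: "integrable P (\<lambda>\<omega>. f j (\<lambda>i. X (\<pi> i) \<omega>))" if "j \<in> S" "\<pi> permutes ?N" for j \<pi>
  proof -
    have "(\<lambda>\<omega>. f j (\<lambda>i\<in>U j. X (\<pi> i) \<omega>)) \<in> borel_measurable P"
      using U(1)[OF that(1)] permutes_image[OF that(2)]
      by (intro measurable_compose[OF measurable_select meas[OF that(1)]]) blast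
    then have "(\<lambda>\<omega>. f j (\<lambda>i. X (\<pi> i) \<omega>)) \<in> borel_measurable P"
      by (subst dep[OF that(1), symmetric])
    then show ?thesis using f01[OF that(1)] by (intro integrable_const_bound[of _ 1]) auto
  qed
  have f_exch: "expectation (\<lambda>\<omega>. f j (\<lambda>i. X (\<pi> i) \<omega>)) = expectation (\<lambda>\<omega>. f j (?Xv \<omega>))"
    if "j \<in> S" "\<pi> permutes ?N" for j \<pi>
  proof -
    have "expectation (\<lambda>\<omega>. f j (\<lambda>i\<in>U j. X (\<pi> i) \<omega>)) = expectation (\<lambda>\<omega>. f j (\<lambda>i\<in>U j. X i \<omega>))"
      using U(1)[OF that(1)] permutes_image[OF that(2)] permutes_inj_on[OF that(2)]
      by (intro exchangeable meas that) (auto intro: inj_onI)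
    then show ?thesis by (simp only: dep[OF that(1)])
  qed
  \<comment> \<open>Relabelling preserves the law of each summand separately. The joint law of the
    summands may change, but the expectation of their sum does not see it.\<close>
  have EG: "expectation (\<lambda>\<omega>. G l (?Xv \<omega>)) = expectation (\<lambda>\<omega>. p (?Xv \<omega>))" if "l < L" for l
    unfolding G_def p_def using f_exch f_int[OF _ permutes_id] f_int \<sigma>(1) that
    by (simp add: Bochner_Integration.integral_sum cong: sum.cong)
  define F where "F x = exp (s / real L * (\<Sum>l<L. G l x))" for x
  have F_meas: "F \<in> borel_measurable (\<Pi>\<^sub>M i\<in>?N. Z)"
    unfolding F_def using G_meas BN by (intro borel_measurable_exp borel_measurable_times
      borel_measurable_const borel_measurable_sum measurable_compose[OF _ borel_measurable_exp]) auto
  have F_restrict: "F (restrict x ?N) = F x" for x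
    unfolding F_def using G_restrict[OF _ BN] by (metis (no_types, lifting) lessThan_iff sum.cong)
  have EF: "expectation (\<lambda>\<omega>. F (?Xv \<omega>)) \<le> exp (s * expectation (\<lambda>\<omega>. p (?Xv \<omega>)) + s\<^sup>2 / (8 * real L))"
  proof -
    \<comment> \<open>Each of the \<open>L\<close> independent factors has parameter s / L, so the
      quadratic terms add up to L (s / L)^2 / 8 = s^2 / (8 L).\<close>
    let ?t = "s / real L"
    have GX: "(\<lambda>\<omega>. G l (?Xv \<omega>)) \<in> borel_measurable P" if "l < L" for l
      using indep that unfolding indep_vars_def by blast
    have "expectation (\<lambda>\<omega>. F (?Xv \<omega>)) = expectation (\<lambda>\<omega>. \<Prod>l<L. exp (?t * G l (?Xv \<omega>)))"
      by (simp add: F_def sum_distrib_left exp_sum)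
    also have "\<dots> = (\<Prod>l<L. expectation (\<lambda>\<omega>. exp (?t * G l (?Xv \<omega>))))"
    proof (rule indep_vars_lebesgue_integral)
      show "indep_vars (\<lambda>_. borel) (\<lambda>l \<omega>. exp (?t * G l (?Xv \<omega>))) {..<L}"
        by (rule indep_vars_compose2[OF indep]) auto
      show "integrable P (\<lambda>\<omega>. exp (?t * G l (?Xv \<omega>)))" if "l \<in> {..<L}" for l
        using GX that G01 s L by (intro integrable_const_bound[of _ "exp ?t"])
          (auto intro!: mult_left_le divide_nonneg_nonneg measurable_compose[OF _ borel_measurable_exp] borel_measurable_times simp del: times_divide_eq_left)
    qed auto
    also have "\<dots> \<le> (\<Prod>l<L. exp (?t * expectation (\<lambda>\<omega>. p (?Xv \<omega>)) + ?t\<^sup>2 / 8))"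
    proof (intro prod_mono conjI)
      fix l assume l: "l \<in> {..<L}"
      show "expectation (\<lambda>\<omega>. exp (?t * G l (?Xv \<omega>))) \<le> exp (?t * expectation (\<lambda>\<omega>. p (?Xv \<omega>)) + ?t\<^sup>2 / 8)"
        using mgf_le_Hoeffding[of "\<lambda>\<omega>. G l (?Xv \<omega>)" ?t] GX l G01 s EG by simp
    qed (simp add: integral_nonneg_AE)
    also have "\<dots> = exp (real L * (?t * expectation (\<lambda>\<omega>. p (?Xv \<omega>)) + ?t\<^sup>2 / 8))"
      by (simp add: exp_of_nat_mult)
    also have "real L * (?t * expectation (\<lambda>\<omega>. p (?Xv \<omega>)) + ?t\<^sup>2 / 8)
       = s * expectation (\<lambda>\<omega>. p (?Xv \<omega>)) + s\<^sup>2 / (8 * real L)"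
      using L by (simp add: field_simps power2_eq_square)
    finally show ?thesis .
  qed
  \<comment> \<open>For fixed \<open>j\<close> and \<open>l\<close>, composing with
    \<open>\<sigma> j l\<close> on the right permutes \<open>Perm\<close>, so the sum over
    \<open>Perm\<close> absorbs \<open>\<sigma> j l\<close>; then \<open>inv\<close> removes \<pi>
    itself. It is \<open>inv\<close> that confines \<open>x\<close> to
    \<open>space Z\<close>.\<close>
  have p_avg: "p x = (\<Sum>\<pi>\<in>Perm. (\<Sum>l<L. G l (\<lambda>i. x (\<pi> i))) / real L) / real (card Perm)"
    if x: "x ` ?N \<subseteq> space Z" for x
  proof -
    have cP: "real (card Perm) > 0" using fPerm by (simp add: card_gt_0_iff)
    have "(\<Sum>\<pi>\<in>Perm. \<Sum>l<L. G l (\<lambda>i. x (\<pi> i)))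
      = (\<Sum>l<L. \<Sum>\<pi>\<in>Perm. G l (\<lambda>i. x (\<pi> i)))" by (rule sum.swap)
    also have "\<dots> = (\<Sum>l<L. real (card Perm) * p x)"
    proof (intro sum.cong refl)
      fix l assume l: "l \<in> {..<L}"
      have "(\<Sum>\<pi>\<in>Perm. G l (\<lambda>i. x (\<pi> i)))
        = (\<Sum>j\<in>S. \<Sum>\<pi>\<in>Perm. f j (\<lambda>i. x (\<pi> (\<sigma> j l i)))) / real (card S)"
        by (simp add: G_def sum_divide_distrib[symmetric] sum.swap[of _ S Perm])
      also have "(\<Sum>j\<in>S. \<Sum>\<pi>\<in>Perm. f j (\<lambda>i. x (\<pi> (\<sigma> j l i)))) = (\<Sum>j\<in>S. \<Sum>\<pi>\<in>Perm. f j (\<lambda>i. x (\<pi> i)))"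
      proof (rule sum.cong[OF refl])
        fix j assume "j \<in> S"
        then have "\<sigma> j l permutes ?N" using \<sigma> l by auto
        from sum_permutations_compose_right[OF this, of "\<lambda>\<pi>. f j (\<lambda>i. x (\<pi> i))"]
        show "(\<Sum>\<pi>\<in>Perm. f j (\<lambda>i. x (\<pi> (\<sigma> j l i)))) = (\<Sum>\<pi>\<in>Perm. f j (\<lambda>i. x (\<pi> i)))"
          by (simp add: Perm_def o_def)
      qed
      also have "\<dots> = (\<Sum>\<pi>\<in>Perm. \<Sum>j\<in>S. f j (\<lambda>i. x (\<pi> i)))" by (rule sum.swap)
      also have "\<dots> = (\<Sum>\<pi>\<in>Perm. \<Sum>j\<in>S. f j x)"
        using inv x by (intro sum.cong[OF refl, of Perm]) (simp add: Perm_def)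
      finally show "(\<Sum>\<pi>\<in>Perm. G l (\<lambda>i. x (\<pi> i))) = real (card Perm) * p x"
        by (simp add: p_def)
    qed
    finally show ?thesis using cP L by (simp add: sum_divide_distrib[symmetric])
  qed
  have Jensen: "exp (s * p (?Xv \<omega>)) \<le> (\<Sum>\<pi>\<in>Perm. F (\<lambda>i. X (\<pi> i) \<omega>)) / real (card Perm)"
    if "\<omega> \<in> space P" for \<omega>
  proof -
    have "s * p (?Xv \<omega>) = (\<Sum>\<pi>\<in>Perm. s / real L * (\<Sum>l<L. G l (\<lambda>i. X (\<pi> i) \<omega>))) / real (card Perm)"
      using that by (subst p_avg) (auto simp: X_space sum_distrib_left[symmetric] sum_divide_distrib[symmetric])
    then show ?thesis using exp_avg_le[OF fPerm] by (simp only: F_def)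
  qed
  have F_select: "(\<lambda>\<omega>. F (\<lambda>i. X (\<pi> i) \<omega>)) = (\<lambda>\<omega>. F (\<lambda>i\<in>?N. X (\<pi> i) \<omega>))" for \<pi>
    by (subst F_restrict[symmetric]) (rule refl)
  have F_int: "integrable P (\<lambda>\<omega>. F (\<lambda>i. X (\<pi> i) \<omega>))" if "\<pi> \<in> Perm" for \<pi>
  proof -
    have "(\<lambda>\<omega>. F (\<lambda>i. X (\<pi> i) \<omega>)) \<in> borel_measurable P"
      unfolding F_select using permutes_image[of \<pi> ?N] that
      by (intro measurable_compose[OF measurable_select F_meas]) (auto simp: Perm_def)
    moreover have "(\<Sum>l<L. G l x) \<le> real L" for x
      using sum_mono[of "{..<L}" "\<lambda>l. G l x" "\<lambda>_. 1"] G01 by simp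
    then have "F x \<le> exp (s / real L * real L)" for x
      unfolding F_def using s by (intro exp_le_cancel_iff[THEN iffD2] mult_left_mono) auto
    then have "norm (F x) \<le> exp (s / real L * real L)" for x by (simp add: F_def)
    ultimately show ?thesis by (intro integrable_const_bound) auto
  qed
  have pX_meas: "(\<lambda>\<omega>. p (?Xv \<omega>)) \<in> borel_measurable P"
    unfolding p_def using f_int[OF _ permutes_id]
    by (intro borel_measurable_divide borel_measurable_sum borel_measurable_const) auto
  have "expectation (\<lambda>\<omega>. exp (s * p (?Xv \<omega>)))
     \<le> expectation (\<lambda>\<omega>. (\<Sum>\<pi>\<in>Perm. F (\<lambda>i. X (\<pi> i) \<omega>)) / real (card Perm))"
  proof (rule integral_mono_AE)
    show i: "integrable P (\<lambda>\<omega>. (\<Sum>\<pi>\<in>Perm. F (\<lambda>i. X (\<pi> i) \<omega>)) / real (card Perm))"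
      using F_int by auto
    show "integrable P (\<lambda>\<omega>. exp (s * p (?Xv \<omega>)))"
      using pX_meas by (intro Bochner_Integration.integrable_bound[OF i])
        (auto intro!: AE_I2 order_trans[OF Jensen] divide_right_mono)
  qed (use Jensen in auto)
  also have "\<dots> = (\<Sum>\<pi>\<in>Perm. expectation (\<lambda>\<omega>. F (\<lambda>i. X (\<pi> i) \<omega>))) / real (card Perm)"
    using F_int by simp
  also have "\<dots> = (\<Sum>\<pi>\<in>Perm. expectation (\<lambda>\<omega>. F (?Xv \<omega>))) / real (card Perm)"
  proof (intro arg_cong2[of _ _ _ _ "(/)"] sum.cong refl)
    fix \<pi> assume "\<pi> \<in> Perm"
    then have "expectation (\<lambda>\<omega>. F (\<lambda>i\<in>?N. X (\<pi> i) \<omega>)) = expectation (\<lambda>\<omega>. F (\<lambda>i\<in>?N. X i \<omega>))"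
      using permutes_image[of \<pi> ?N] permutes_inj_on[of \<pi>]
      by (intro exchangeable F_meas) (auto simp: Perm_def intro: inj_onI)
    then show "expectation (\<lambda>\<omega>. F (\<lambda>i. X (\<pi> i) \<omega>)) = expectation (\<lambda>\<omega>. F (?Xv \<omega>))"
      by (simp add: F_restrict F_select)
  qed
  also have "\<dots> = expectation (\<lambda>\<omega>. F (?Xv \<omega>))" using fPerm by simp
  finally show ?thesis using EF by linarith
qed

end

section \<open>Covariances of the kernel\<close>

text \<open>Fubini's theorem on the product of the two laws, pulled back to the probability space.
  The inner expectation freezes the first variable and so serves as an explicit conditional
  expectation.\<close>

lemma (in prob_space)
  fixes f :: "'b \<Rightarrow> 'b \<Rightarrow> real"
  assumes ind: "indep_var A Y B W"
    and f [measurable]: "(\<lambda>(x, y). f x y) \<in> borel_measurable (A \<Otimes>\<^sub>M B)"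
    and int: "integrable M (\<lambda>\<omega>. f (Y \<omega>) (W \<omega>))"
  shows expectation_indep_iterated:
      "expectation (\<lambda>\<omega>. f (Y \<omega>) (W \<omega>)) = expectation (\<lambda>\<omega>. expectation (\<lambda>\<omega>'. f (Y \<omega>) (W \<omega>')))"
    and integrable_indep_iterated: "integrable M (\<lambda>\<omega>. expectation (\<lambda>\<omega>'. f (Y \<omega>) (W \<omega>')))"
proof -
  have Y [measurable]: "random_variable A Y" and W [measurable]: "random_variable B W"
    and D: "distr M A Y \<Otimes>\<^sub>M distr M B W = distr M (A \<Otimes>\<^sub>M B) (\<lambda>x. (Y x, W x))"
    using ind by (simp_all add: indep_var_distribution_eq)
  interpret D1: prob_space "distr M A Y" by (rule prob_space_distr) fact
  interpret D2: prob_space "distr M B W" by (rule prob_space_distr) fact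
  interpret D12: pair_prob_space "distr M A Y" "distr M B W" ..
  have i: "integrable (distr M A Y \<Otimes>\<^sub>M distr M B W) (\<lambda>(x, y). f x y)"
    unfolding D using int by (subst integrable_distr_eq) auto
  have inner: "(\<integral>y. f x y \<partial>distr M B W) = expectation (\<lambda>\<omega>'. f x (W \<omega>'))" if "x \<in> space A" for x
    using measurable_Pair2[OF f that] by (intro integral_distr) auto
  have m [measurable]: "(\<lambda>x. \<integral>y. f x y \<partial>distr M B W) \<in> borel_measurable A"
    by (intro D2.borel_measurable_lebesgue_integral)
       (simp add: f[unfolded measurable_cong_sets[OF sets_pair_measure_cong[OF refl sets_distr] refl]])
  have "expectation (\<lambda>\<omega>. f (Y \<omega>) (W \<omega>)) = (\<integral>z. (\<lambda>(x, y). f x y) z \<partial>(distr M A Y \<Otimes>\<^sub>M distr M B W))"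
    unfolding D by (subst integral_distr) auto
  also have "\<dots> = (\<integral>x. (\<integral>y. f x y \<partial>distr M B W) \<partial>distr M A Y)"
    using D12.integral_fst'[OF i] by simp
  also have "\<dots> = expectation (\<lambda>\<omega>. \<integral>y. f (Y \<omega>) y \<partial>distr M B W)"
    by (intro integral_distr) auto
  also have "\<dots> = expectation (\<lambda>\<omega>. expectation (\<lambda>\<omega>'. f (Y \<omega>) (W \<omega>')))"
    by (intro Bochner_Integration.integral_cong refl inner measurable_space[OF Y])
  finally show "expectation (\<lambda>\<omega>. f (Y \<omega>) (W \<omega>)) = expectation (\<lambda>\<omega>. expectation (\<lambda>\<omega>'. f (Y \<omega>) (W \<omega>')))" .
  have "integrable (distr M A Y) (\<lambda>x. \<integral>y. f x y \<partial>distr M B W)"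
    using D12.integrable_fst'[OF i] by simp
  then have "integrable M (\<lambda>\<omega>. \<integral>y. f (Y \<omega>) y \<partial>distr M B W)"
    by (subst (asm) integrable_distr_eq) auto
  then show "integrable M (\<lambda>\<omega>. expectation (\<lambda>\<omega>'. f (Y \<omega>) (W \<omega>')))"
    by (rule Bochner_Integration.integrable_cong[THEN iffD1, rotated -1])
       (auto intro: inner measurable_space[OF Y])
qed

lemma subalgebra_vimage:
  assumes Y: "Y \<in> measurable M N"
  shows "subalgebra M (vimage_algebra (space M) Y N)"
proof -
  have "sets (vimage_algebra (space M) Y N) = {Y -` A \<inter> space M |A. A \<in> sets N}"
    using measurable_space[OF Y] by (intro sets_vimage_algebra2) auto
  then show ?thesis using measurable_sets[OF Y] by (auto simp: subalgebra_def)
qed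

lemma integrable_mult_of_squares:
  fixes a b :: "'a \<Rightarrow> real"
  assumes "a \<in> borel_measurable M" "b \<in> borel_measurable M"
    and i: "integrable M (\<lambda>x. (a x)\<^sup>2)" "integrable M (\<lambda>x. (b x)\<^sup>2)"
  shows "integrable M (\<lambda>x. a x * b x)"
proof (rule Bochner_Integration.integrable_bound[OF Bochner_Integration.integrable_add[OF i]])
  have "\<bar>u * v\<bar> \<le> u\<^sup>2 + v\<^sup>2" for u v :: real
  proof -
    have "0 \<le> (\<bar>u\<bar> - \<bar>v\<bar>)\<^sup>2 + \<bar>u\<bar> * \<bar>v\<bar>" by simp
    also have "\<dots> = u\<^sup>2 + v\<^sup>2 - \<bar>u * v\<bar>" by (simp add: power2_diff abs_mult)
    finally show ?thesis by simp
  qed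
  then show "AE x in M. norm (a x * b x) \<le> norm ((a x)\<^sup>2 + (b x)\<^sup>2)" by simp
qed (use assms in auto)

text \<open>Lists of distinct indices play the role of the injections, so that a covariance at
  \<open>[i, k, l]\<close> can be moved to \<open>[1, 2, 3]\<close>.\<close>

lemma (in iid_sample) exchangeable_list:
  fixes F :: "(nat \<Rightarrow> 'z) \<Rightarrow> real"
  assumes "distinct is" "set is \<subseteq> {1..n}" "distinct js" "set js \<subseteq> {1..n}" "length is = k" "length js = k"
    and F: "F \<in> borel_measurable (\<Pi>\<^sub>M i\<in>{..<k}. Z)"
  shows "expectation (\<lambda>\<omega>. F (\<lambda>i\<in>{..<k}. X (is ! i) \<omega>)) = expectation (\<lambda>\<omega>. F (\<lambda>i\<in>{..<k}. X (js ! i) \<omega>))"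
    and "integrable P (\<lambda>\<omega>. F (\<lambda>i\<in>{..<k}. X (is ! i) \<omega>)) \<longleftrightarrow> integrable P (\<lambda>\<omega>. F (\<lambda>i\<in>{..<k}. X (js ! i) \<omega>))"
proof -
  have *: "inj_on ((!) is) {..<k}" "inj_on ((!) js) {..<k}"
    "(!) is ` {..<k} \<subseteq> {1..n}" "(!) js ` {..<k} \<subseteq> {1..n}"
    using assms by (auto intro!: inj_on_nth)
  show "expectation (\<lambda>\<omega>. F (\<lambda>i\<in>{..<k}. X (is ! i) \<omega>)) = expectation (\<lambda>\<omega>. F (\<lambda>i\<in>{..<k}. X (js ! i) \<omega>))"
    by (rule exchangeable[OF *(3,1,4,2) F])
  show "integrable P (\<lambda>\<omega>. F (\<lambda>i\<in>{..<k}. X (is ! i) \<omega>)) \<longleftrightarrow> integrable P (\<lambda>\<omega>. F (\<lambda>i\<in>{..<k}. X (js ! i) \<omega>))"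
    by (rule exchangeable_integrable[OF *(3,1,4,2) F])
qed

text \<open>\<open>n_ge\<close> makes room for the distinct indices 1, 2 and 3 and for division by n
  - 1; in the theorem the sample size turns out to be at least 12.\<close>

locale iid_kernel = iid_sample +
  fixes h :: "'b \<Rightarrow> 'b \<Rightarrow> real"
  assumes h_meas: "(\<lambda>(x, y). h x y) \<in> borel_measurable (Z \<Otimes>\<^sub>M Z)"
    and h_sym: "\<And>x y. x \<in> space Z \<Longrightarrow> y \<in> space Z \<Longrightarrow> h x y = h y x"
    and h_sq: "integrable P (\<lambda>\<omega>. (h (X 1 \<omega>) (X 2 \<omega>))\<^sup>2)"
    and n_ge: "4 \<le> n"
begin

definition g :: "'b \<Rightarrow> 'b \<Rightarrow> real" where "g x y = h x y - theta P X h"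

text \<open>The first Hoeffding projection of the centred kernel: \<open>g1 (X 1 \<omega>)\<close>
  is a version of the conditional expectation of the kernel given \<open>X 1\<close>, minus
  \<theta>.\<close>

definition g1 :: "'b \<Rightarrow> real" where "g1 x = expectation (\<lambda>\<omega>. g x (X 2 \<omega>))"

lemma g_meas [measurable]: "(\<lambda>(x, y). g x y) \<in> borel_measurable (Z \<Otimes>\<^sub>M Z)"
  using h_meas unfolding g_def by measurable

lemma g_meas2 [measurable (raw)]:
  assumes "u \<in> measurable M Z" "v \<in> measurable M Z"
  shows "(\<lambda>x. g (u x) (v x)) \<in> borel_measurable M"
  using measurable_compose[OF measurable_Pair[OF assms] g_meas] by simp

lemma g_sym: "x \<in> space Z \<Longrightarrow> y \<in> space Z \<Longrightarrow> g x y = g y x"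
  using h_sym by (simp add: g_def)

lemma g_pair_meas: "i \<in> {1..n} \<Longrightarrow> k \<in> {1..n} \<Longrightarrow> (\<lambda>\<omega>. g (X i \<omega>) (X k \<omega>)) \<in> borel_measurable P"
  by (intro g_meas2 X_measurable)

lemma small_index: "i \<in> {1..4} \<Longrightarrow> i \<in> {1..n}"
  using n_ge by auto

lemma g12_sq: "integrable P (\<lambda>\<omega>. (g (X 1 \<omega>) (X 2 \<omega>))\<^sup>2)" and h12_int: "integrable P (\<lambda>\<omega>. h (X 1 \<omega>) (X 2 \<omega>))"
proof -
  have "(\<lambda>\<omega>. h (X 1 \<omega>) (X 2 \<omega>)) \<in> borel_measurable P"
    using measurable_compose[OF measurable_Pair[OF X_measurable X_measurable] h_meas, OF small_index small_index, of 1 2]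
    by simp
  then show *: "integrable P (\<lambda>\<omega>. h (X 1 \<omega>) (X 2 \<omega>))"
    using h_sq by (rule square_integrable_imp_integrable)
  with h_sq show "integrable P (\<lambda>\<omega>. (g (X 1 \<omega>) (X 2 \<omega>))\<^sup>2)"
    by (simp add: g_def power2_diff)
qed

lemma g_pair_sq:
  assumes "i \<in> {1..n}" "k \<in> {1..n}" "i \<noteq> k"
  shows "integrable P (\<lambda>\<omega>. (g (X i \<omega>) (X k \<omega>))\<^sup>2)"
    and "expectation (\<lambda>\<omega>. (g (X i \<omega>) (X k \<omega>))\<^sup>2) = sigma_sq P X h"
proof -
  have F: "(\<lambda>x. (g (x 0) (x 1))\<^sup>2) \<in> borel_measurable (\<Pi>\<^sub>M i\<in>{..<2 :: nat}. Z)"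
    by (intro borel_measurable_power g_meas2 measurable_component_singleton) auto
  have *: "distinct [i, k]" "set [i, k] \<subseteq> {1..n}" "distinct [1, 2 :: nat]" "set [1, 2] \<subseteq> {1..n}"
    "length [i, k] = 2" "length [1, 2 :: nat] = 2"
    using assms n_ge by auto
  show "integrable P (\<lambda>\<omega>. (g (X i \<omega>) (X k \<omega>))\<^sup>2)"
    using exchangeable_list(2)[OF * F] g12_sq by simp
  show "expectation (\<lambda>\<omega>. (g (X i \<omega>) (X k \<omega>))\<^sup>2) = sigma_sq P X h"
    using exchangeable_list(1)[OF * F] unfolding sigma_sq_def theta_def[symmetric] g_def[symmetric] by simp
qed

lemma g_pair_mult:
  assumes "i \<in> {1..n}" "k \<in> {1..n}" "i \<noteq> k" "i' \<in> {1..n}" "k' \<in> {1..n}" "i' \<noteq> k'"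
  shows "integrable P (\<lambda>\<omega>. g (X i \<omega>) (X k \<omega>) * g (X i' \<omega>) (X k' \<omega>))"
  using assms by (intro integrable_mult_of_squares g_pair_meas g_pair_sq)

lemma g_pair_int:
  assumes "i \<in> {1..n}" "k \<in> {1..n}" "i \<noteq> k"
  shows "integrable P (\<lambda>\<omega>. g (X i \<omega>) (X k \<omega>))"
    and "expectation (\<lambda>\<omega>. g (X i \<omega>) (X k \<omega>)) = 0"
proof -
  show "integrable P (\<lambda>\<omega>. g (X i \<omega>) (X k \<omega>))"
    using assms by (intro square_integrable_imp_integrable[OF g_pair_meas g_pair_sq(1)])
  have F: "(\<lambda>x. g (x 0) (x 1)) \<in> borel_measurable (\<Pi>\<^sub>M i\<in>{..<2 :: nat}. Z)"
    by (intro g_meas2 measurable_component_singleton) auto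
  have *: "distinct [i, k]" "set [i, k] \<subseteq> {1..n}" "distinct [1, 2 :: nat]" "set [1, 2] \<subseteq> {1..n}"
    "length [i, k] = 2" "length [1, 2 :: nat] = 2"
    using assms n_ge by auto
  have "expectation (\<lambda>\<omega>. g (X i \<omega>) (X k \<omega>)) = expectation (\<lambda>\<omega>. g (X 1 \<omega>) (X 2 \<omega>))"
    using exchangeable_list(1)[OF * F] by simp
  also have "\<dots> = expectation (\<lambda>\<omega>. h (X 1 \<omega>) (X 2 \<omega>)) - theta P X h"
    unfolding g_def using h12_int by (subst Bochner_Integration.integral_diff) (auto simp: prob_space)
  finally show "expectation (\<lambda>\<omega>. g (X i \<omega>) (X k \<omega>)) = 0"
    by (simp add: theta_def)
qed

lemma cov_disjoint:
  assumes "i \<in> {1..n}" "k \<in> {1..n}" "i \<noteq> k" "i' \<in> {1..n}" "k' \<in> {1..n}" "i' \<noteq> k'"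
    and "{i, k} \<inter> {i', k'} = {}"
  shows "expectation (\<lambda>\<omega>. g (X i \<omega>) (X k \<omega>) * g (X i' \<omega>) (X k' \<omega>)) = 0"
proof -
  have "indep_var borel ((\<lambda>x. g (x i) (x k)) \<circ> (\<lambda>\<omega>. restrict (\<lambda>i. X i \<omega>) {i, k}))
    borel ((\<lambda>x. g (x i') (x k')) \<circ> (\<lambda>\<omega>. restrict (\<lambda>i. X i \<omega>) {i', k'}))"
    using assms by (intro indep_var_compose[OF indep_var_restrict[OF X_indep]]) measurable
  from indep_var_lebesgue_integral[OF this] show ?thesis
    using assms g_pair_int by (simp add: o_def)
qed

text \<open>Independence allows \<open>X 2\<close> to be integrated out with \<open>X 1\<close>
  frozen. The cases of a constant and of an indicator for \<open>\<phi>\<close> identify the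
  conditional expectation given \<open>X 1\<close>; the case \<open>g1\<close> yields its second
  moment.\<close>

lemma integral_first_coordinate:
  fixes \<phi> :: "'b \<Rightarrow> real"
  assumes \<phi>: "\<phi> \<in> borel_measurable Z"
    and int: "integrable P (\<lambda>\<omega>. \<phi> (X 1 \<omega>) * g (X 1 \<omega>) (X 2 \<omega>))"
  shows "expectation (\<lambda>\<omega>. \<phi> (X 1 \<omega>) * g (X 1 \<omega>) (X 2 \<omega>)) = expectation (\<lambda>\<omega>. \<phi> (X 1 \<omega>) * g1 (X 1 \<omega>))"
    and "integrable P (\<lambda>\<omega>. \<phi> (X 1 \<omega>) * g1 (X 1 \<omega>))"
proof -
  let ?f = "\<lambda>(y :: nat \<Rightarrow> 'b) (w :: nat \<Rightarrow> 'b). \<phi> (y 1) * g (y 1) (w 2)"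
  have ind: "indep_var (\<Pi>\<^sub>M i\<in>{1}. Z) (\<lambda>\<omega>. restrict (\<lambda>i. X i \<omega>) {1})
    (\<Pi>\<^sub>M i\<in>{2}. Z) (\<lambda>\<omega>. restrict (\<lambda>i. X i \<omega>) {2})"
    using n_ge by (intro indep_var_restrict[OF X_indep]) auto
  have f: "(\<lambda>(y, w). ?f y w) \<in> borel_measurable ((\<Pi>\<^sub>M i\<in>{1}. Z) \<Otimes>\<^sub>M (\<Pi>\<^sub>M i\<in>{2}. Z))"
    unfolding split_beta'
    by (intro borel_measurable_times g_meas2 measurable_compose[OF _ \<phi>]
        measurable_compose[OF measurable_fst measurable_component_singleton]
        measurable_compose[OF measurable_snd measurable_component_singleton]) auto
  have i: "integrable P (\<lambda>\<omega>. ?f (restrict (\<lambda>i. X i \<omega>) {1}) (restrict (\<lambda>i. X i \<omega>) {2}))"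
    using int by simp
  show "expectation (\<lambda>\<omega>. \<phi> (X 1 \<omega>) * g (X 1 \<omega>) (X 2 \<omega>)) = expectation (\<lambda>\<omega>. \<phi> (X 1 \<omega>) * g1 (X 1 \<omega>))"
    using expectation_indep_iterated[where f = ?f, OF ind f i] by (simp add: g1_def)
  show "integrable P (\<lambda>\<omega>. \<phi> (X 1 \<omega>) * g1 (X 1 \<omega>))"
    using integrable_indep_iterated[where f = ?f, OF ind f i] by (simp add: g1_def)
qed

lemma g1_meas: "g1 \<in> borel_measurable Z"
proof -
  have "(\<lambda>x. \<integral>y. g x y \<partial>distr P Z (X 2)) \<in> borel_measurable Z"
  proof -
    interpret D: prob_space "distr P Z (X 2)" using n_ge by (intro prob_space_distr X_measurable) auto
    have "sets (Z \<Otimes>\<^sub>M distr P Z (X 2)) = sets (Z \<Otimes>\<^sub>M Z)" by (intro sets_pair_measure_cong) auto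
    from g_meas[folded measurable_cong_sets[OF this refl]] show ?thesis
      by (rule D.borel_measurable_lebesgue_integral)
  qed
  moreover have "(\<integral>y. g x y \<partial>distr P Z (X 2)) = g1 x" if "x \<in> space Z" for x
    unfolding g1_def using n_ge that by (intro integral_distr X_measurable g_meas2) auto
  ultimately show ?thesis by (simp cong: measurable_cong)
qed

text \<open>Integrating out \<open>X 3\<close> turns the factor
  \<open>g (X 1 \<omega>) (X 3 \<omega>)\<close> into \<open>g1 (X 1 \<omega>)\<close>; integrating
  out \<open>X 2\<close> then does the same to the other factor. Square integrability of
  \<open>g1\<close> comes out of the same two steps.\<close>

lemma cov_share:
  "integrable P (\<lambda>\<omega>. (g1 (X 1 \<omega>))\<^sup>2)"
  "expectation (\<lambda>\<omega>. g (X 1 \<omega>) (X 2 \<omega>) * g (X 1 \<omega>) (X 3 \<omega>)) = expectation (\<lambda>\<omega>. (g1 (X 1 \<omega>))\<^sup>2)"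
proof -
  let ?f = "\<lambda>(y :: nat \<Rightarrow> 'b) (w :: nat \<Rightarrow> 'b). g (y 1) (y 2) * g (y 1) (w 3)"
  have ind: "indep_var (\<Pi>\<^sub>M i\<in>{1, 2}. Z) (\<lambda>\<omega>. restrict (\<lambda>i. X i \<omega>) {1, 2})
    (\<Pi>\<^sub>M i\<in>{3}. Z) (\<lambda>\<omega>. restrict (\<lambda>i. X i \<omega>) {3})"
    using n_ge by (intro indep_var_restrict[OF X_indep]) auto
  have f: "(\<lambda>(y, w). ?f y w) \<in> borel_measurable ((\<Pi>\<^sub>M i\<in>{1, 2}. Z) \<Otimes>\<^sub>M (\<Pi>\<^sub>M i\<in>{3}. Z))"
    unfolding split_beta'
    by (intro borel_measurable_times g_meas2
        measurable_compose[OF measurable_fst measurable_component_singleton]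
        measurable_compose[OF measurable_snd measurable_component_singleton]) auto
  have "integrable P (\<lambda>\<omega>. g (X 1 \<omega>) (X 2 \<omega>) * g (X 1 \<omega>) (X 3 \<omega>))"
    using n_ge by (intro g_pair_mult) auto
  then have i: "integrable P (\<lambda>\<omega>. ?f (restrict (\<lambda>i. X i \<omega>) {1, 2}) (restrict (\<lambda>i. X i \<omega>) {3}))"
    by simp
  have g1: "expectation (\<lambda>\<omega>. g x (X 3 \<omega>)) = g1 x" if "x \<in> space Z" for x
  proof -
    have F: "(\<lambda>z. g x (z 0)) \<in> borel_measurable (\<Pi>\<^sub>M i\<in>{..<1 :: nat}. Z)"
      using that by (intro g_meas2 measurable_component_singleton) auto
    have *: "distinct [3 :: nat]" "set [3] \<subseteq> {1..n}" "distinct [2 :: nat]" "set [2] \<subseteq> {1..n}"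
      "length [3 :: nat] = 1" "length [2 :: nat] = 1"
      using n_ge by auto
    show ?thesis using exchangeable_list(1)[OF * F] by (simp add: g1_def)
  qed
  have inner: "expectation (\<lambda>\<omega>'. ?f (restrict (\<lambda>i. X i \<omega>) {1, 2}) (restrict (\<lambda>i. X i \<omega>') {3}))
      = g1 (X 1 \<omega>) * g (X 1 \<omega>) (X 2 \<omega>)" if "\<omega> \<in> space P" for \<omega>
    using g1[of "X 1 \<omega>"] X_space[of 1 \<omega>] n_ge that by simp
  have e: "expectation (\<lambda>\<omega>. g (X 1 \<omega>) (X 2 \<omega>) * g (X 1 \<omega>) (X 3 \<omega>))
      = expectation (\<lambda>\<omega>. g1 (X 1 \<omega>) * g (X 1 \<omega>) (X 2 \<omega>))"
    using expectation_indep_iterated[where f = ?f, OF ind f i] Bochner_Integration.integral_cong[OF refl inner] by simp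
  have i1: "integrable P (\<lambda>\<omega>. g1 (X 1 \<omega>) * g (X 1 \<omega>) (X 2 \<omega>))"
    by (rule Bochner_Integration.integrable_cong[OF refl inner, THEN iffD1, OF _
          integrable_indep_iterated[where f = ?f, OF ind f i]])
  note r = integral_first_coordinate[OF g1_meas i1]
  show "integrable P (\<lambda>\<omega>. (g1 (X 1 \<omega>))\<^sup>2)" using r(2) by (simp add: power2_eq_square)
  show "expectation (\<lambda>\<omega>. g (X 1 \<omega>) (X 2 \<omega>) * g (X 1 \<omega>) (X 3 \<omega>)) = expectation (\<lambda>\<omega>. (g1 (X 1 \<omega>))\<^sup>2)"
    unfolding e using r(1) by (simp add: power2_eq_square)
qed

text \<open>Sets of the \<sigma>-algebra generated by \<open>X 1\<close> are preimages under
  \<open>X 1\<close>, so their indicators are functions of \<open>X 1\<close>. Hence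
  \<open>integral_first_coordinate\<close> verifies the defining property of the conditional
  expectation for \<open>g1 (X 1 \<omega>)\<close> plus \<theta>.\<close>

lemma sigma1_sq_eq: "sigma1_sq P Z X h = expectation (\<lambda>\<omega>. (g1 (X 1 \<omega>))\<^sup>2)"
proof -
  let ?F = "vimage_algebra (space P) (X 1) Z" and ?h = "\<lambda>\<omega>. h (X 1 \<omega>) (X 2 \<omega>)"
  let ?\<theta> = "theta P X h"
  have X1: "X 1 \<in> measurable P Z" using n_ge by (intro X_measurable) auto
  have setsF: "sets ?F = {X 1 -` A \<inter> space P |A. A \<in> sets Z}"
    using measurable_space[OF X1] by (intro sets_vimage_algebra2) auto
  interpret F: finite_measure_subalgebra P ?F
    by unfold_locales (rule subalgebra_vimage[OF X1])
  have X1F: "X 1 \<in> measurable ?F Z"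
    by (intro measurable_vimage_algebra1 funcsetI measurable_space[OF X1])
  have g12: "integrable P (\<lambda>\<omega>. g (X 1 \<omega>) (X 2 \<omega>))" "expectation (\<lambda>\<omega>. g (X 1 \<omega>) (X 2 \<omega>)) = 0"
    using n_ge by (intro g_pair_int; simp)+
  note one = integral_first_coordinate[of "\<lambda>_. 1", simplified, OF g12(1)[simplified]]
  have g1_int: "integrable P (\<lambda>\<omega>. g1 (X 1 \<omega>))" and g1_0: "expectation (\<lambda>\<omega>. g1 (X 1 \<omega>)) = 0"
    using one g12(2) by simp_all
  have ce: "AE \<omega> in P. real_cond_exp P ?F ?h \<omega> = g1 (X 1 \<omega>) + ?\<theta>"
  proof (rule F.real_cond_exp_charact)
    fix A assume "A \<in> sets ?F"
    then obtain B where B: "B \<in> sets Z" "A = X 1 -` B \<inter> space P"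
      unfolding setsF by blast
    have A: "A \<in> sets P" using B X1 by auto
    have ind: "indicator A \<omega> = (indicator B (X 1 \<omega>) :: real)" if "\<omega> \<in> space P" for \<omega>
      using that B by (auto simp: indicator_def)
    have iA: "integrable P (indicator A :: _ \<Rightarrow> real)" using A by (intro integrable_const_bound[of _ 1]) auto
    have ig: "integrable P (\<lambda>\<omega>. indicator A \<omega> * g (X 1 \<omega>) (X 2 \<omega>))"
      using integrable_mult_indicator[OF A g12(1)] by simp
    have ig1: "integrable P (\<lambda>\<omega>. indicator A \<omega> * g1 (X 1 \<omega>))"
      using integrable_mult_indicator[OF A g1_int] by simp
    have ig': "integrable P (\<lambda>\<omega>. indicator B (X 1 \<omega>) * g (X 1 \<omega>) (X 2 \<omega>))"
      using ig by (rule Bochner_Integration.integrable_cong[THEN iffD1, rotated -1]) (auto simp: ind)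
    have "expectation (\<lambda>\<omega>. indicator A \<omega> * g (X 1 \<omega>) (X 2 \<omega>))
      = expectation (\<lambda>\<omega>. indicator B (X 1 \<omega>) * g (X 1 \<omega>) (X 2 \<omega>))"
      by (intro Bochner_Integration.integral_cong refl) (simp add: ind)
    also have "\<dots> = expectation (\<lambda>\<omega>. indicator B (X 1 \<omega>) * g1 (X 1 \<omega>))"
      using B ig' by (intro integral_first_coordinate) auto
    also have "\<dots> = expectation (\<lambda>\<omega>. indicator A \<omega> * g1 (X 1 \<omega>))"
      by (intro Bochner_Integration.integral_cong refl) (simp add: ind)
    finally have eq: "expectation (\<lambda>\<omega>. indicator A \<omega> * g (X 1 \<omega>) (X 2 \<omega>)) = expectation (\<lambda>\<omega>. indicator A \<omega> * g1 (X 1 \<omega>))" .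
    have "(\<integral>\<omega>\<in>A. ?h \<omega> \<partial>P) = expectation (\<lambda>\<omega>. indicator A \<omega> * g (X 1 \<omega>) (X 2 \<omega>) + indicator A \<omega> * ?\<theta>)"
      unfolding set_lebesgue_integral_def g_def by (simp add: algebra_simps)
    also have "\<dots> = expectation (\<lambda>\<omega>. indicator A \<omega> * g1 (X 1 \<omega>) + indicator A \<omega> * ?\<theta>)"
      using ig ig1 iA eq by (subst (1 2) Bochner_Integration.integral_add) (auto intro: integrable_mult_left)
    also have "\<dots> = (\<integral>\<omega>\<in>A. (g1 (X 1 \<omega>) + ?\<theta>) \<partial>P)"
      unfolding set_lebesgue_integral_def by (simp add: algebra_simps)
    finally show "(\<integral>\<omega>\<in>A. ?h \<omega> \<partial>P) = (\<integral>\<omega>\<in>A. (g1 (X 1 \<omega>) + ?\<theta>) \<partial>P)" .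
  next
    show "integrable P ?h" by (rule h12_int)
    show "integrable P (\<lambda>\<omega>. g1 (X 1 \<omega>) + ?\<theta>)" using g1_int by auto
    show "(\<lambda>\<omega>. g1 (X 1 \<omega>) + ?\<theta>) \<in> borel_measurable ?F"
      using measurable_compose[OF X1F g1_meas] by auto
  qed
  have ce_meas: "real_cond_exp P ?F ?h \<in> borel_measurable P"
    by (rule borel_measurable_cond_exp2)
  have g1X: "(\<lambda>\<omega>. g1 (X 1 \<omega>)) \<in> borel_measurable P" by (rule measurable_compose[OF X1 g1_meas])
  have "expectation (real_cond_exp P ?F ?h) = expectation (\<lambda>\<omega>. g1 (X 1 \<omega>) + ?\<theta>)"
    by (intro integral_cong_AE ce ce_meas borel_measurable_add g1X borel_measurable_const)
  also have "\<dots> = ?\<theta>" using g1_int g1_0 by (simp add: prob_space)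
  finally have m: "expectation (real_cond_exp P ?F ?h) = ?\<theta>" .
  show ?thesis unfolding sigma1_sq_def m
  proof (intro integral_cong_AE borel_measurable_power borel_measurable_diff borel_measurable_const ce_meas g1X)
    show "AE \<omega> in P. (real_cond_exp P ?F ?h \<omega> - ?\<theta>)\<^sup>2 = (g1 (X 1 \<omega>))\<^sup>2"
      using ce by eventually_elim simp
  qed
qed

end

section \<open>Counting index pairs and the variance of the complete U-statistic\<close>

lemma finite_index_pairs: "finite (index_pairs n)"
  by (rule finite_subset[of _ "{1..n} \<times> {1..n}"]) (auto simp: index_pairs_def)

lemma index_pairs_mem:
  "a \<in> index_pairs n \<longleftrightarrow> fst a \<in> {1..n} \<and> snd a \<in> {1..n} \<and> fst a < snd a"
  by (cases a) (auto simp: index_pairs_def)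

text \<open>The index \<open>i\<close> is the first entry of n - i pairs and the second entry of i -
  1 pairs.\<close>

lemma index_pairs_degree:
  assumes "i \<in> {1..n}"
  shows "(\<Sum>b\<in>index_pairs n. of_bool (i = fst b) + of_bool (i = snd b)) = real n - 1"
proof -
  have "index_pairs n \<inter> {b. i = fst b} = Pair i ` {i<..n}"
    using assms by (auto simp: index_pairs_def)
  then have 1: "card (index_pairs n \<inter> {b. i = fst b}) = n - i"
    by (simp add: card_image inj_on_def)
  have "index_pairs n \<inter> {b. i = snd b} = (\<lambda>k. (k, i)) ` {1..<i}"
    using assms by (auto simp: index_pairs_def)
  then have 2: "card (index_pairs n \<inter> {b. i = snd b}) = i - 1"
    by (simp add: card_image inj_on_def)
  show ?thesis
    using 1 2 assms by (simp add: sum.distrib of_bool_def sum.If_cases finite_index_pairs)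
qed

text \<open>Double counting of incidences: every pair has two entries, and every index lies in n - 1
  pairs.\<close>

lemma card_index_pairs: "2 * real (card (index_pairs n)) = real n * (real n - 1)"
proof -
  have "(\<Sum>i\<in>{1..n}. of_bool (i = fst b) + of_bool (i = snd b)) = (2 :: real)"
    if "b \<in> index_pairs n" for b
    using that by (simp add: sum.distrib of_bool_def sum.If_cases index_pairs_mem Int_absorb1)
  then have "2 * real (card (index_pairs n))
      = (\<Sum>b\<in>index_pairs n. \<Sum>i\<in>{1..n}. of_bool (i = fst b) + of_bool (i = snd b))"
    by simp
  also have "\<dots> = (\<Sum>i\<in>{1..n}. \<Sum>b\<in>index_pairs n. of_bool (i = fst b) + of_bool (i = snd b))"
    by (rule sum.swap)
  also have "\<dots> = (\<Sum>i\<in>{1..n}. real n - 1)"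
    by (intro sum.cong[OF refl] index_pairs_degree)
  finally show ?thesis by simp
qed

context iid_kernel begin

definition gp :: "nat \<times> nat \<Rightarrow> 'a \<Rightarrow> real" where
  "gp a \<omega> = g (X (fst a) \<omega>) (X (snd a) \<omega>)"

lemma cov_common_index:
  assumes "distinct [i, k, l]" "set [i, k, l] \<subseteq> {1..n}"
  shows "expectation (\<lambda>\<omega>. g (X i \<omega>) (X k \<omega>) * g (X i \<omega>) (X l \<omega>)) = sigma1_sq P Z X h"
proof -
  have F: "(\<lambda>x. g (x 0) (x 1) * g (x 0) (x 2)) \<in> borel_measurable (\<Pi>\<^sub>M i\<in>{..<3 :: nat}. Z)"
    by (intro borel_measurable_times g_meas2 measurable_component_singleton) auto
  have *: "distinct [1, 2, 3 :: nat]" "set [1, 2, 3] \<subseteq> {1..n}" "length [i, k, l] = 3" "length [1, 2, 3 :: nat] = 3"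
    using n_ge by auto
  show ?thesis
    using exchangeable_list(1)[OF assms * F] cov_share(2) sigma1_sq_eq by simp
qed

text \<open>
  Written with indicators, the case distinction on the number of common indices can be summed over
  all pairs by counting the pairs through a given index.
\<close>

lemma cov_pairs:
  assumes a: "a \<in> index_pairs n" and b: "b \<in> index_pairs n"
  shows "expectation (\<lambda>\<omega>. gp a \<omega> * gp b \<omega>) = of_bool (a = b) * sigma2_sq P Z X h
    + sigma1_sq P Z X h * (of_bool (fst a = fst b) + of_bool (fst a = snd b)
      + (of_bool (snd a = fst b) + of_bool (snd a = snd b)))"
proof -
  obtain i k where ak: "a = (i, k)" by (cases a)
  obtain i' k' where bk: "b = (i', k')" by (cases b)
  have o: "i \<in> {1..n}" "k \<in> {1..n}" "i' \<in> {1..n}" "k' \<in> {1..n}" and lt: "i < k" "i' < k'"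
    using a b ak bk by (auto simp: index_pairs_mem)
  have swap: "g (X u \<omega>) (X v \<omega>) = g (X v \<omega>) (X u \<omega>)" if "\<omega> \<in> space P" "u \<in> {1..n}" "v \<in> {1..n}" for u v \<omega>
    using that by (intro g_sym X_space)
  let ?E = "expectation (\<lambda>\<omega>. g (X i \<omega>) (X k \<omega>) * g (X i' \<omega>) (X k' \<omega>))"
  consider (same) "i = i'" "k = k'" | (fst) "i = i'" "k \<noteq> k'" | (snd) "i \<noteq> i'" "k = k'"
    | (fs) "i = k'" | (sf) "k = i'" | (disj) "{i, k} \<inter> {i', k'} = {}"
    by auto
  then show ?thesis
  proof cases
    case same
    then have "?E = sigma_sq P X h"
      using g_pair_sq(2)[of i k] o lt by (simp add: power2_eq_square)
    \<comment> \<open>Two of the four indicators equal 1 here, and \<open>sigma2_sq\<close> plus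
      twice \<open>sigma1_sq\<close> is \<open>sigma_sq\<close>.\<close>
    then show ?thesis using same lt by (simp add: ak bk gp_def sigma2_sq_def)
  next
    case fst
    then have "?E = sigma1_sq P Z X h"
      using cov_common_index[of i k k'] o lt by simp
    then show ?thesis using fst lt by (simp add: ak bk gp_def)
  next
    case snd
    have "?E = expectation (\<lambda>\<omega>. g (X k \<omega>) (X i \<omega>) * g (X k \<omega>) (X i' \<omega>))"
      using snd o by (intro Bochner_Integration.integral_cong refl) (metis swap)
    also have "\<dots> = sigma1_sq P Z X h"
      using cov_common_index[of k i i'] o lt snd by simp
    finally show ?thesis using snd lt by (simp add: ak bk gp_def)
  next
    case fs
    \<comment> \<open>The orders i' < k' = i < k exclude any further coincidence of indices.\<close>
    have "?E = expectation (\<lambda>\<omega>. g (X i \<omega>) (X k \<omega>) * g (X i \<omega>) (X i' \<omega>))"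
      using fs o by (intro Bochner_Integration.integral_cong refl) (metis swap)
    also have "\<dots> = sigma1_sq P Z X h"
      using cov_common_index[of i k i'] o lt fs by simp
    finally show ?thesis using fs lt by (simp add: ak bk gp_def)
  next
    case sf
    have "?E = expectation (\<lambda>\<omega>. g (X k \<omega>) (X i \<omega>) * g (X k \<omega>) (X k' \<omega>))"
      using sf o by (intro Bochner_Integration.integral_cong refl) (metis swap)
    also have "\<dots> = sigma1_sq P Z X h"
      using cov_common_index[of k i k'] o lt sf by simp
    finally show ?thesis using sf lt by (simp add: ak bk gp_def)
  next
    case disj
    then have "?E = 0" using o lt by (intro cov_disjoint) auto
    then show ?thesis using disj by (simp add: ak bk gp_def)
  qed
qed

lemma gp_int:
  assumes "a \<in> index_pairs n" "b \<in> index_pairs n"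
  shows "integrable P (\<lambda>\<omega>. gp a \<omega> * gp b \<omega>)" "integrable P (\<lambda>\<omega>. (gp a \<omega>)\<^sup>2)"
    "expectation (\<lambda>\<omega>. (gp a \<omega>)\<^sup>2) = sigma_sq P X h"
  unfolding gp_def using assms by (intro g_pair_mult g_pair_sq; auto simp: index_pairs_mem)+

text \<open>Hoeffding's variance formula. By \<open>index_pairs_degree\<close> at both entries of
  \<open>a\<close>, every row of the covariance matrix has the same sum \<open>sigma2_sq\<close> + 2
  (n - 1) \<open>sigma1_sq\<close>, and there are n (n - 1) / 2 rows.\<close>

lemma variance_U_statistic:
  defines "N \<equiv> real (card (index_pairs n))"
  shows "integrable P (\<lambda>\<omega>. ((\<Sum>a\<in>index_pairs n. gp a \<omega>) / N)\<^sup>2)"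
    and "expectation (\<lambda>\<omega>. ((\<Sum>a\<in>index_pairs n. gp a \<omega>) / N)\<^sup>2)
      = 4 * sigma1_sq P Z X h / real n + 2 * sigma2_sq P Z X h / (real n * (real n - 1))"
proof -
  let ?I = "index_pairs n" and ?s1 = "sigma1_sq P Z X h" and ?s2 = "sigma2_sq P Z X h"
  have N: "2 * N = real n * (real n - 1)" unfolding N_def by (rule card_index_pairs)
  have n: "real n > 0" "real n - 1 > 0" using n_ge by auto
  have "2 * N > 0" unfolding N using n by (rule mult_pos_pos)
  then have Npos: "N > 0" by simp
  have sq: "((\<Sum>a\<in>?I. gp a \<omega>) / N)\<^sup>2 = (\<Sum>a\<in>?I. \<Sum>b\<in>?I. gp a \<omega> * gp b \<omega>) / N\<^sup>2" for \<omega>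
    by (simp add: power_divide power2_eq_square sum_product)
  show "integrable P (\<lambda>\<omega>. ((\<Sum>a\<in>?I. gp a \<omega>) / N)\<^sup>2)"
    unfolding sq by (intro integrable_divide Bochner_Integration.integrable_sum gp_int(1))
  have "expectation (\<lambda>\<omega>. ((\<Sum>a\<in>?I. gp a \<omega>) / N)\<^sup>2)
      = (\<Sum>a\<in>?I. \<Sum>b\<in>?I. expectation (\<lambda>\<omega>. gp a \<omega> * gp b \<omega>)) / N\<^sup>2"
    unfolding sq by (simp add: gp_int(1) Bochner_Integration.integral_sum Bochner_Integration.integrable_sum)
  also have "(\<Sum>a\<in>?I. \<Sum>b\<in>?I. expectation (\<lambda>\<omega>. gp a \<omega> * gp b \<omega>)) = (\<Sum>a\<in>?I. ?s2 + ?s1 * (2 * (real n - 1)))"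
  proof (rule sum.cong[OF refl])
    fix a assume a: "a \<in> ?I"
    then have i: "fst a \<in> {1..n}" "snd a \<in> {1..n}" by (auto simp: index_pairs_mem)
    have "(\<Sum>b\<in>?I. expectation (\<lambda>\<omega>. gp a \<omega> * gp b \<omega>))
      = (\<Sum>b\<in>?I. of_bool (a = b) * ?s2) + ?s1 * ((\<Sum>b\<in>?I. of_bool (fst a = fst b) + of_bool (fst a = snd b))
        + (\<Sum>b\<in>?I. of_bool (snd a = fst b) + of_bool (snd a = snd b)))"
      unfolding sum.distrib[symmetric] sum_distrib_left
      by (intro sum.cong refl cov_pairs[OF a])
    also have "(\<Sum>b\<in>?I. of_bool (a = b) * ?s2) = ?s2"
      using a finite_index_pairs by (simp add: of_bool_def if_distrib[of "\<lambda>x. x * _"] cong: if_cong)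
    finally show "(\<Sum>b\<in>?I. expectation (\<lambda>\<omega>. gp a \<omega> * gp b \<omega>)) = ?s2 + ?s1 * (2 * (real n - 1))"
      unfolding index_pairs_degree[OF i(1)] index_pairs_degree[OF i(2)] by simp
  qed
  also have "\<dots> / N\<^sup>2 = (?s2 + ?s1 * (2 * (real n - 1))) / N"
    using Npos by (simp add: N_def[symmetric] power2_eq_square)
  also have "\<dots> = (2 * ?s2 + 4 * ?s1 * (real n - 1)) / (2 * N)"
    using Npos by (simp add: field_simps)
  also have "\<dots> = 4 * ?s1 / real n + 2 * ?s2 / (real n * (real n - 1))"
    unfolding N using n by (simp add: add_divide_distrib)
  finally show "expectation (\<lambda>\<omega>. ((\<Sum>a\<in>?I. gp a \<omega>) / N)\<^sup>2) = 4 * ?s1 / real n + 2 * ?s2 / (real n * (real n - 1))" .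
qed

text \<open>\<open>R\<close> is the second moment of a centred block mean with the sample held
  fixed. By \<open>avg_square_mean_draws_le\<close> it is at most the sum of two terms: the mean of
  the squared centred kernel over all pairs, divided by \<open>M\<close>, whose expectation is
  \<sigma>^2 / M, and the square of the complete centred U-statistic.\<close>

lemma avg_block_variance:
  fixes M :: nat
  assumes M: "0 < M"
  defines "S \<equiv> {1..M} \<rightarrow>\<^sub>E index_pairs n"
  defines "R \<equiv> \<lambda>\<omega>. (\<Sum>j\<in>S. ((\<Sum>m\<in>{1..M}. gp (j m) \<omega>) / real M)\<^sup>2) / real (card S)"
  shows "integrable P R"
    and "expectation R \<le> 4 * sigma1_sq P Z X h / real n + 2 * sigma2_sq P Z X h / (real n * (real n - 1))
      + sigma_sq P X h / real M"
proof -
  let ?I = "index_pairs n"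
  have "(1, 2) \<in> ?I" using n_ge by (simp add: index_pairs_mem)
  then have I: "finite ?I" "?I \<noteq> {}" using finite_index_pairs by auto
  have c: "real (card ?I) > 0" using I by (simp add: card_gt_0_iff)
  have sq: "((\<Sum>m\<in>{1..M}. gp (j m) \<omega>) / real M)\<^sup>2
    = (\<Sum>m\<in>{1..M}. \<Sum>m'\<in>{1..M}. gp (j m) \<omega> * gp (j m') \<omega>) / (real M)\<^sup>2" for j \<omega>
    by (simp add: power_divide power2_eq_square sum_product)
  have jm: "j m \<in> ?I" if "j \<in> S" "m \<in> {1..M}" for j m
    using that by (auto simp: S_def)
  show R_int: "integrable P R"
    unfolding R_def sq
    by (intro integrable_divide Bochner_Integration.integrable_sum gp_int(1) jm)
  have le: "R \<omega> \<le> (\<Sum>a\<in>?I. (gp a \<omega>)\<^sup>2) / real (card ?I) / real M + ((\<Sum>a\<in>?I. gp a \<omega>) / real (card ?I))\<^sup>2" for \<omega>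
    unfolding R_def S_def
    using avg_square_mean_draws_le[of "{1..M}" ?I "\<lambda>a. gp a \<omega>"] I M by simp
  have i1: "integrable P (\<lambda>\<omega>. (\<Sum>a\<in>?I. (gp a \<omega>)\<^sup>2) / real (card ?I) / real M)"
    by (intro integrable_divide Bochner_Integration.integrable_sum gp_int(2))
  have e1: "expectation (\<lambda>\<omega>. (\<Sum>a\<in>?I. (gp a \<omega>)\<^sup>2) / real (card ?I) / real M) = sigma_sq P X h / real M"
    using c gp_int(2,3) by (simp add: Bochner_Integration.integral_sum)
  have "expectation R \<le> expectation (\<lambda>\<omega>. (\<Sum>a\<in>?I. (gp a \<omega>)\<^sup>2) / real (card ?I) / real M
      + ((\<Sum>a\<in>?I. gp a \<omega>) / real (card ?I))\<^sup>2)"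
    using le by (intro integral_mono R_int Bochner_Integration.integrable_add i1 variance_U_statistic(1))
  also have "\<dots> = sigma_sq P X h / real M + (4 * sigma1_sq P Z X h / real n + 2 * sigma2_sq P Z X h / (real n * (real n - 1)))"
    using Bochner_Integration.integral_add[OF i1 variance_U_statistic(1)]
    unfolding e1 variance_U_statistic(2) by simp
  finally show "expectation R \<le> 4 * sigma1_sq P Z X h / real n + 2 * sigma2_sq P Z X h / (real n * (real n - 1))
      + sigma_sq P X h / real M" by simp
qed

end

section \<open>The fraction of deviating blocks\<close>

context iid_kernel begin

definition block_mean :: "nat \<Rightarrow> (nat \<Rightarrow> nat \<times> nat) \<Rightarrow> (nat \<Rightarrow> 'b) \<Rightarrow> real" where
  "block_mean M j x = (\<Sum>m\<in>{1..M}. g (x (fst (j m))) (x (snd (j m)))) / real M"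

text \<open>Relabelling the sample amounts to relabelling the pairs, which permutes the set of
  blocks. A pair whose order \<pi> reverses is sorted again, and this uses the symmetry of the
  kernel, available on \<open>space Z\<close>.\<close>

lemma block_mean_relabel:
  fixes M :: nat and \<phi> :: "real \<Rightarrow> real"
  assumes \<pi>: "\<pi> permutes {1..n}" and x: "x ` {1..n} \<subseteq> space Z"
  defines "S \<equiv> {1..M} \<rightarrow>\<^sub>E index_pairs n"
  shows "(\<Sum>j\<in>S. \<phi> (block_mean M j (\<lambda>i. x (\<pi> i)))) = (\<Sum>j\<in>S. \<phi> (block_mean M j x))"
proof -
  let ?I = "index_pairs n"
  define r where "r a = (min (\<pi> (fst a)) (\<pi> (snd a)), max (\<pi> (fst a)) (\<pi> (snd a)))" for a
  define act where "act j = (\<lambda>m\<in>{1..M}. r (j m))" for j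
  have inj: "\<pi> u = \<pi> v \<longleftrightarrow> u = v" for u v using permutes_inj[OF \<pi>] by (simp add: inj_eq)
  have rI: "r a \<in> ?I" if "a \<in> ?I" for a
    using that permutes_in_image[OF \<pi>] inj[of "fst a" "snd a"]
    by (auto simp: r_def index_pairs_mem min_def max_def)
  \<comment> \<open>Equal images mean equal unordered pairs, and an unordered pair has only one
    increasing arrangement.\<close>
  have r_inj: "inj_on r ?I"
  proof (rule inj_onI)
    fix a b assume a: "a \<in> ?I" and b: "b \<in> ?I" and "r a = r b"
    then have "fst a = fst b \<and> snd a = snd b \<or> fst a = snd b \<and> snd a = fst b"
      by (auto simp: r_def min_def max_def inj split: if_splits)
    then show "a = b" using a b by (auto simp: index_pairs_mem prod_eq_iff)
  qed
  have fS: "finite S" unfolding S_def by (intro finite_PiE finite_index_pairs) auto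
  have act_S: "act ` S \<subseteq> S"
  proof (rule image_subsetI)
    fix j assume "j \<in> S"
    then have "r (j m) \<in> ?I" if "m \<in> {1..M}" for m using that by (intro rI) (auto simp: S_def)
    then show "act j \<in> S" unfolding act_def S_def by (simp add: restrict_PiE_iff)
  qed
  have "inj_on act S"
  proof (rule inj_onI)
    fix j j' assume j: "j \<in> S" "j' \<in> S" and eq: "act j = act j'"
    show "j = j'"
    proof (rule PiE_ext)
      show "j \<in> {1..M} \<rightarrow>\<^sub>E ?I" "j' \<in> {1..M} \<rightarrow>\<^sub>E ?I" using j by (auto simp: S_def)
      fix m assume m: "m \<in> {1..M}"
      then have "r (j m) = r (j' m)" using fun_cong[OF eq, of m] by (simp add: act_def)
      moreover have "j m \<in> ?I" "j' m \<in> ?I" using j m PiE_mem unfolding S_def by fast+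
      ultimately show "j m = j' m" by (rule inj_onD[OF r_inj])
    qed
  qed
  with act_S fS have bij: "bij_betw act S S" by (simp add: bij_betw_def endo_inj_surj)
  have "block_mean M j (\<lambda>i. x (\<pi> i)) = block_mean M (act j) x" if "j \<in> S" for j
  proof -
    have "g (x (\<pi> (fst (j m)))) (x (\<pi> (snd (j m)))) = g (x (fst (act j m))) (x (snd (act j m)))"
      if m: "m \<in> {1..M}" for m
    proof -
      have "j m \<in> ?I" using \<open>j \<in> S\<close> m by (auto simp: S_def)
      then have "\<pi> (fst (j m)) \<in> {1..n}" "\<pi> (snd (j m)) \<in> {1..n}"
        using permutes_in_image[OF \<pi>] by (auto simp: index_pairs_mem)
      then have "x (\<pi> (fst (j m))) \<in> space Z" "x (\<pi> (snd (j m))) \<in> space Z" using x by blast+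
      then show ?thesis using m g_sym by (simp add: act_def r_def min_def max_def)
    qed
    then show ?thesis unfolding block_mean_def by (metis (no_types, lifting) sum.cong)
  qed
  then have "(\<Sum>j\<in>S. \<phi> (block_mean M j (\<lambda>i. x (\<pi> i)))) = (\<Sum>j\<in>S. \<phi> (block_mean M (act j) x))"
    by (intro sum.cong) auto
  also have "\<dots> = (\<Sum>j\<in>S. \<phi> (block_mean M j x))"
    by (rule sum.reindex_bij_betw[OF bij])
  finally show ?thesis .
qed

lemma block_mean_meas:
  assumes "\<And>m. m \<in> {1..M} \<Longrightarrow> fst (j m) \<in> I \<and> snd (j m) \<in> I"
  shows "block_mean M j \<in> borel_measurable (\<Pi>\<^sub>M i\<in>I. Z)"
  unfolding block_mean_def using assms
  by (intro borel_measurable_divide borel_measurable_sum borel_measurable_const g_meas2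
      measurable_component_singleton) auto

text \<open>Chebyshev's inequality block by block inside the average: \<epsilon>^2 times the
  indicator of a deviation is at most the squared block mean. Hence \<epsilon>^2 times
  \<open>p\<close> is at most \<open>R\<close>, whose expectation is at most \<tau> \<epsilon>^2 /
  3.\<close>

lemma deviation_fraction_mean_le:
  fixes M :: nat and \<epsilon> \<tau> :: real
  assumes M: "0 < M" and \<epsilon>: "0 \<le> \<epsilon>" and t: "0 < \<tau>"
    and V: "3 * (4 * sigma1_sq P Z X h / real n + 2 * sigma2_sq P Z X h / (real n * (real n - 1))
      + sigma_sq P X h / real M) \<le> \<tau> * \<epsilon>\<^sup>2"
  defines "S \<equiv> {1..M} \<rightarrow>\<^sub>E index_pairs n"
  defines "p \<equiv> \<lambda>\<omega>. (\<Sum>j\<in>S. indicator {\<epsilon><..} \<bar>block_mean M j (\<lambda>i. X i \<omega>)\<bar>) / real (card S) :: real"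
  shows "expectation p \<le> \<tau> / 3" and "p \<in> borel_measurable P" and "\<And>\<omega>. 0 \<le> p \<omega> \<and> p \<omega> \<le> 1"
proof -
  let ?D = "\<lambda>j \<omega>. block_mean M j (\<lambda>i. X i \<omega>)"
  define R where "R \<omega> = (\<Sum>j\<in>S. (?D j \<omega>)\<^sup>2) / real (card S)" for \<omega>
  have "R = (\<lambda>\<omega>. (\<Sum>j\<in>S. ((\<Sum>m\<in>{1..M}. gp (j m) \<omega>) / real M)\<^sup>2) / real (card S))"
    by (simp add: fun_eq_iff R_def block_mean_def gp_def)
  note R_bound = avg_block_variance[OF M, folded S_def, folded this]
  have "3 * expectation R \<le> \<tau> * \<epsilon>\<^sup>2"
    by (rule order_trans[OF mult_left_mono[OF R_bound(2)] V]) simp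
  with R_bound(1) have R: "integrable P R" "expectation R \<le> \<tau> * \<epsilon>\<^sup>2 / 3" by simp_all
  have fS: "finite S" unfolding S_def by (intro finite_PiE finite_index_pairs) auto
  have D_meas: "?D j \<in> borel_measurable P" if "j \<in> S" for j
  proof -
    have jm: "fst (j m) \<in> {1..n} \<and> snd (j m) \<in> {1..n}" if "m \<in> {1..M}" for m
    proof -
      have "j m \<in> index_pairs n" using \<open>j \<in> S\<close> that by (auto simp: S_def)
      then show ?thesis by (simp add: index_pairs_mem)
    qed
    then show ?thesis unfolding block_mean_def
      by (intro borel_measurable_divide borel_measurable_sum borel_measurable_const g_pair_meas) auto
  qed
  show p_meas: "p \<in> borel_measurable P"
    unfolding p_def using D_meas
    by (intro borel_measurable_divide borel_measurable_sum borel_measurable_const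
        measurable_compose[OF borel_measurable_abs borel_measurable_indicator]) auto
  show p01: "0 \<le> p \<omega> \<and> p \<omega> \<le> 1" for \<omega>
  proof -
    have "(\<Sum>j\<in>S. indicator {\<epsilon><..} \<bar>?D j \<omega>\<bar>) \<le> (\<Sum>j\<in>S. 1 :: real)"
      by (intro sum_mono) (simp add: indicator_def)
    then have "(\<Sum>j\<in>S. indicator {\<epsilon><..} \<bar>?D j \<omega>\<bar>) \<le> real (card S)" by simp
    then show ?thesis unfolding p_def by (auto intro!: divide_nonneg_nonneg sum_nonneg divide_le_eq_1[THEN iffD2])
  qed
  have p_int: "integrable P p"
    using p_meas p01 by (intro integrable_const_bound[of _ 1]) auto
  have pR: "p \<omega> * \<epsilon>\<^sup>2 \<le> R \<omega>" for \<omega>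
  proof -
    have "indicator {\<epsilon><..} \<bar>?D j \<omega>\<bar> * \<epsilon>\<^sup>2 \<le> (?D j \<omega>)\<^sup>2" for j
      using \<epsilon> by (auto simp: indicator_def abs_le_square_iff[symmetric])
    then show ?thesis unfolding p_def R_def
      by (simp add: sum_distrib_right divide_right_mono sum_mono)
  qed
  show "expectation p \<le> \<tau> / 3"
  proof (cases "\<epsilon> = 0")
    case True
    \<comment> \<open>For \<epsilon> = 0 one cannot divide by \<epsilon>^2. Instead \<open>R\<close>
      has expectation 0, so almost surely every block mean vanishes, and the strict inequality that
      defines a deviation fails.\<close>
    have R0: "0 \<le> R \<omega>" for \<omega> by (auto simp: R_def intro!: divide_nonneg_nonneg sum_nonneg)
    with R True have "expectation R = 0" by (intro antisym) (auto intro: integral_nonneg_AE)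
    then have "AE \<omega> in P. R \<omega> = 0"
      using integral_nonneg_eq_0_iff_AE[OF R(1)] R0 by auto
    then have "AE \<omega> in P. p \<omega> = 0"
    proof eventually_elim
      case (elim \<omega>)
      have "?D j \<omega> = 0" if "j \<in> S" for j
      proof -
        have "card S \<noteq> 0" using that fS by auto
        then have "(\<Sum>j\<in>S. (?D j \<omega>)\<^sup>2) = 0" using elim by (simp add: R_def)
        then show ?thesis using that fS by (simp add: sum_nonneg_eq_0_iff)
      qed
      then show ?case using \<epsilon> by (simp add: p_def indicator_def)
    qed
    then have "expectation p = 0" by (intro integral_eq_zero_AE)
    then show ?thesis using t by simp
  next
    case False
    with \<epsilon> have e: "\<epsilon>\<^sup>2 > 0" by simp
    have "expectation p * \<epsilon>\<^sup>2 = expectation (\<lambda>\<omega>. p \<omega> * \<epsilon>\<^sup>2)" by simp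
    also have "\<dots> \<le> expectation R"
      using p_int R(1) pR by (intro integral_mono) auto
    also have "\<dots> \<le> (\<tau> / 3) * \<epsilon>\<^sup>2" using R(2) by simp
    finally show ?thesis using e by simp
  qed
qed

lemma deviation_fraction_tail:
  fixes M L :: nat and \<epsilon> \<tau> :: real
  assumes M: "0 < M" and L: "0 < L" "L * (2 * M) \<le> n" and \<epsilon>: "0 \<le> \<epsilon>" and t: "0 < \<tau>"
    and V: "3 * (4 * sigma1_sq P Z X h / real n + 2 * sigma2_sq P Z X h / (real n * (real n - 1))
      + sigma_sq P X h / real M) \<le> \<tau> * \<epsilon>\<^sup>2"
  defines "S \<equiv> {1..M} \<rightarrow>\<^sub>E index_pairs n"
  defines "p \<equiv> \<lambda>\<omega>. (\<Sum>j\<in>S. indicator {\<epsilon><..} \<bar>block_mean M j (\<lambda>i. X i \<omega>)\<bar>) / real (card S) :: real"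
  shows "prob {\<omega> \<in> space P. \<tau> \<le> p \<omega>} \<le> exp (- 8 * real L * \<tau>\<^sup>2 / 9)"
proof -
  note mean = deviation_fraction_mean_le[OF M \<epsilon> t V, folded S_def, folded p_def]
  define f where "f j x = (indicator {\<epsilon><..} \<bar>block_mean M j x\<bar> :: real)" for j x
  \<comment> \<open>The sample indices read by block \<open>j\<close>: at most \<open>2 * M\<close>,
    and fewer when indices repeat.\<close>
  define U where "U j = fst ` j ` {1..M} \<union> snd ` j ` {1..M}" for j :: "nat \<Rightarrow> nat \<times> nat"
  \<comment> \<open>The minimiser of - 2 s \<tau> / 3 + s^2 / (8 L), the exponent left when the mean
    of \<open>p\<close> is replaced by \<tau> / 3; the minimum is - 8 L \<tau>^2 / 9.\<close>
  define s where "s = 8 * real L * \<tau> / 3"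
  have s: "0 \<le> s" using t by (simp add: s_def)
  have "(1, 2) \<in> index_pairs n" using n_ge by (simp add: index_pairs_mem)
  then have S: "finite S" "S \<noteq> {}"
    unfolding S_def by (auto intro!: finite_PiE finite_index_pairs simp: PiE_eq_empty_iff)
  have jm: "j m \<in> index_pairs n" if "j \<in> S" "m \<in> {1..M}" for j m
    using that by (auto simp: S_def)
  have mgf: "expectation (\<lambda>\<omega>. exp (s * p \<omega>)) \<le> exp (s * expectation p + s\<^sup>2 / (8 * real L))"
    unfolding p_def f_def[symmetric]
  proof (rule avg_mgf_le[OF S _ _ _ _ _ L s])
    fix j x assume j: "j \<in> S"
    show "0 \<le> f j x \<and> f j x \<le> 1" by (simp add: f_def indicator_def)
    have "block_mean M j (restrict x (U j)) = block_mean M j x"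
      unfolding block_mean_def
      by (intro arg_cong2[of _ _ _ _ "(/)"] sum.cong refl arg_cong2[of _ _ _ _ g]) (auto simp: U_def)
    then show "f j (restrict x (U j)) = f j x" by (simp add: f_def)
    have "block_mean M j \<in> borel_measurable (\<Pi>\<^sub>M i\<in>U j. Z)"
      by (rule block_mean_meas) (simp add: U_def)
    then show "f j \<in> borel_measurable (\<Pi>\<^sub>M i\<in>U j. Z)"
      unfolding f_def by (intro measurable_compose[OF borel_measurable_abs borel_measurable_indicator]) auto
    show "U j \<subseteq> {1..n}" using jm[OF j] unfolding U_def by (auto simp: index_pairs_mem)
    have "card (fst ` j ` {1..M}) \<le> M" "card (snd ` j ` {1..M}) \<le> M"
      using card_image_le[of "{1..M}" "\<lambda>m. fst (j m)"] card_image_le[of "{1..M}" "\<lambda>m. snd (j m)"]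
      by (simp_all add: image_image)
    then show "card (U j) \<le> 2 * M"
      unfolding U_def using card_Un_le[of "fst ` j ` {1..M}" "snd ` j ` {1..M}"] by linarith
  next
    fix \<pi> x assume "\<pi> permutes {1..n}" "x ` {1..n} \<subseteq> space Z"
    then show "(\<Sum>j\<in>S. f j (\<lambda>i. x (\<pi> i))) = (\<Sum>j\<in>S. f j x)"
      unfolding f_def S_def by (rule block_mean_relabel[where \<phi> = "\<lambda>y. indicator {\<epsilon><..} \<bar>y\<bar>"])
  qed
  have p01: "0 \<le> p \<omega>" "p \<omega> \<le> 1" for \<omega>
    using mean(3)[of \<omega>] by (simp_all add: p_def)
  have p_int: "integrable P (\<lambda>\<omega>. exp (s * p \<omega>))"
    using mean(2) p01 s by (intro integrable_const_bound[of _ "exp s"])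
      (auto intro!: mult_left_le measurable_compose[OF _ borel_measurable_exp])
  have "{\<omega> \<in> space P. \<tau> \<le> p \<omega>} \<subseteq> {\<omega> \<in> space P. exp (s * \<tau>) \<le> exp (s * p \<omega>)}"
    using s by (auto intro: mult_left_mono)
  moreover have "{\<omega> \<in> space P. exp (s * \<tau>) \<le> exp (s * p \<omega>)} \<in> events"
    using p_int by measurable
  ultimately have "prob {\<omega> \<in> space P. \<tau> \<le> p \<omega>} \<le> prob {\<omega> \<in> space P. exp (s * \<tau>) \<le> exp (s * p \<omega>)}"
    by (rule finite_measure_mono)
  also have "\<dots> \<le> expectation (\<lambda>\<omega>. exp (s * p \<omega>)) / exp (s * \<tau>)"
    using integral_Markov_inequality_measure[OF p_int, where c = "exp (s * \<tau>)" and A = "space P"]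
    by (simp add: Collect_conj_eq[symmetric])
  also have "\<dots> \<le> exp (s * (\<tau> / 3) + s\<^sup>2 / (8 * real L)) / exp (s * \<tau>)"
    using mean(1) s by (intro divide_right_mono order_trans[OF mgf]) (auto intro: mult_left_mono simp del: times_divide_eq_right)
  also have "\<dots> = exp (s * (\<tau> / 3) + s\<^sup>2 / (8 * real L) - s * \<tau>)" by (simp only: exp_diff)
  also have "s * (\<tau> / 3) + s\<^sup>2 / (8 * real L) - s * \<tau> = - 8 * real L * \<tau>\<^sup>2 / 9"
    using L unfolding s_def power2_eq_square by (simp add: field_simps)
  finally show ?thesis .
qed

end

text \<open>As \<open>Jf\<close> takes finitely many values, conditioning on it is a finite sum:
  where \<open>Jf\<close> equals \<open>j\<close>, the random target \<open>E (Jf \<omega>)\<close>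
  is the fixed set \<open>E j\<close>, and independence factorises the probability.\<close>

lemma (in prob_space)
  fixes Jf :: "'a \<Rightarrow> 'j" and Xf :: "'a \<Rightarrow> 'x"
  assumes ind: "indep_rvs M N Jf Q Xf"
    and T: "finite T" "\<And>\<omega>. \<omega> \<in> space M \<Longrightarrow> Jf \<omega> \<in> T" "\<And>j. j \<in> T \<Longrightarrow> {j} \<in> sets N"
    and E: "\<And>j. j \<in> T \<Longrightarrow> E j \<in> sets Q"
  shows events_mixture: "{\<omega> \<in> space M. Xf \<omega> \<in> E (Jf \<omega>)} \<in> events"
    and prob_mixture: "prob {\<omega> \<in> space M. Xf \<omega> \<in> E (Jf \<omega>)}
      = (\<Sum>j\<in>T. prob {\<omega> \<in> space M. Jf \<omega> = j} * prob {\<omega> \<in> space M. Xf \<omega> \<in> E j})"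
proof -
  have J: "random_variable N Jf" and X: "random_variable Q Xf"
    and I: "indep_set (sets (vimage_algebra (space M) Jf N)) (sets (vimage_algebra (space M) Xf Q))"
    using ind by (auto simp: indep_rvs_def)
  have A: "{\<omega> \<in> space M. Jf \<omega> = j} \<in> sets (vimage_algebra (space M) Jf N)" if "j \<in> T" for j
    using in_vimage_algebra[OF T(3)[OF that], of Jf "space M"] by (auto simp: vimage_def Int_def conj_commute)
  have B: "{\<omega> \<in> space M. Xf \<omega> \<in> E j} \<in> sets (vimage_algebra (space M) Xf Q)" if "j \<in> T" for j
    using in_vimage_algebra[OF E[OF that], of Xf "space M"] by (auto simp: vimage_def Int_def conj_commute)
  have sub: "sets (vimage_algebra (space M) Jf N) \<subseteq> events" "sets (vimage_algebra (space M) Xf Q) \<subseteq> events"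
    using subalgebra_vimage[OF J] subalgebra_vimage[OF X] by (auto simp: subalgebra_def)
  define C where "C j = {\<omega> \<in> space M. Jf \<omega> = j} \<inter> {\<omega> \<in> space M. Xf \<omega> \<in> E j}" for j
  have C: "C j \<in> events" if "j \<in> T" for j using A[OF that] B[OF that] sub by (auto simp: C_def)
  have U: "{\<omega> \<in> space M. Xf \<omega> \<in> E (Jf \<omega>)} = (\<Union>j\<in>T. C j)"
    using T(2) by (auto simp: C_def)
  show "{\<omega> \<in> space M. Xf \<omega> \<in> E (Jf \<omega>)} \<in> events"
    unfolding U using T(1) C by (intro sets.finite_UN) auto
  have "prob (\<Union>j\<in>T. C j) = (\<Sum>j\<in>T. prob (C j))"
    using T(1) C by (intro finite_measure_finite_Union) (auto simp: disjoint_family_on_def C_def)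
  also have "\<dots> = (\<Sum>j\<in>T. prob {\<omega> \<in> space M. Jf \<omega> = j} * prob {\<omega> \<in> space M. Xf \<omega> \<in> E j})"
    unfolding C_def by (intro sum.cong refl indep_setD[OF I] A B)
  finally show "prob {\<omega> \<in> space M. Xf \<omega> \<in> E (Jf \<omega>)}
      = (\<Sum>j\<in>T. prob {\<omega> \<in> space M. Jf \<omega> = j} * prob {\<omega> \<in> space M. Xf \<omega> \<in> E j})"
    unfolding U .
qed

text \<open>Applied at two levels: to the \<open>M\<close> pairs within one block, and then to the
  \<open>K\<close> blocks, each of which is uniform by the first application.\<close>

lemma (in prob_space) prob_uniform_tuple:
  assumes ind: "indep_vars (\<lambda>_. N) Y A" and A: "finite A" "A \<noteq> {}"
    and I: "finite I" "\<And>i. i \<in> I \<Longrightarrow> {i} \<in> sets N"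
    and unif: "\<And>k i. k \<in> A \<Longrightarrow> i \<in> I \<Longrightarrow> prob {\<omega> \<in> space M. Y k \<omega> = i} = 1 / real (card I)"
    and j: "j \<in> A \<rightarrow>\<^sub>E I"
  shows "prob {\<omega> \<in> space M. (\<lambda>k\<in>A. Y k \<omega>) = j} = 1 / real (card (A \<rightarrow>\<^sub>E I))"
proof -
  have "{\<omega> \<in> space M. (\<lambda>k\<in>A. Y k \<omega>) = j} = (\<Inter>k\<in>A. Y k -` {j k} \<inter> space M)"
  proof -
    have "(\<lambda>k\<in>A. y k) = j \<longleftrightarrow> (\<forall>k\<in>A. y k = j k)" for y
      using j by (auto simp: fun_eq_iff PiE_iff extensional_def)
    then show ?thesis using A(2) by auto
  qed
  also have "prob \<dots> = (\<Prod>k\<in>A. prob (Y k -` {j k} \<inter> space M))"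
    using j A I by (intro indep_varsD_finite[OF ind]) auto
  also have "\<dots> = (\<Prod>k\<in>A. 1 / real (card I))"
  proof (rule prod.cong[OF refl])
    fix k assume k: "k \<in> A"
    have "Y k -` {j k} \<inter> space M = {\<omega> \<in> space M. Y k \<omega> = j k}" by auto
    moreover have "j k \<in> I" using k j by auto
    ultimately show "prob (Y k -` {j k} \<inter> space M) = 1 / real (card I)" using unif k by simp
  qed
  also have "\<dots> = 1 / real (card (A \<rightarrow>\<^sub>E I))"
    using A by (simp add: card_PiE power_one_over)
  finally show ?thesis .
qed

section \<open>The median of the blocks\<close>

context iid_kernel begin

lemma incomplete_U_eq:
  assumes "0 < M"
  shows "incomplete_U X h M Jk \<omega> = block_mean M (\<lambda>m\<in>{1..M}. Jk m \<omega>) (\<lambda>i. X i \<omega>) + theta P X h"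
proof -
  have "block_mean M (\<lambda>m\<in>{1..M}. Jk m \<omega>) (\<lambda>i. X i \<omega>) = block_mean M (\<lambda>m. Jk m \<omega>) (\<lambda>i. X i \<omega>)"
    unfolding block_mean_def by (intro arg_cong2[of _ _ _ _ "(/)"] sum.cong refl) simp
  then show ?thesis using assms
    by (simp add: incomplete_U_def block_mean_def g_def sum_subtractf diff_divide_distrib split_beta)
qed

lemma block_mean_restrict:
  assumes "j \<in> {1..M} \<rightarrow>\<^sub>E index_pairs n"
  shows "block_mean M j (restrict x {1..n}) = block_mean M j x"
proof -
  have "fst (j m) \<in> {1..n} \<and> snd (j m) \<in> {1..n}" if "m \<in> {1..M}" for m
    using PiE_mem[OF assms that] by (simp add: index_pairs_mem)
  then show ?thesis unfolding block_mean_def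
    by (intro arg_cong2[of _ _ _ _ "(/)"] sum.cong refl arg_cong2[of _ _ _ _ g]) auto
qed

text \<open>By \<open>prob_mixture\<close> the probability is the average, over all arrays
  \<open>j\<close> of draws, of the probability that the sample lies in \<open>E j\<close>.
  Exchanging this average with the expectation leaves, for each fixed sample, the fraction of arrays
  whose median deviates: at most the Hoeffding term where \<open>p\<close> is below \<tau>, and at
  most 1 elsewhere. So the sample gets fixed without conditional probabilities.\<close>

lemma MoIU_deviation_prob:
  fixes J :: "nat \<Rightarrow> nat \<Rightarrow> 'a \<Rightarrow> nat \<times> nat" and K M L :: nat and \<epsilon> \<tau> :: real
  assumes K: "0 < K" and M: "0 < M" and L: "0 < L" "L * (2 * M) \<le> n"
    and \<epsilon>: "0 \<le> \<epsilon>" and t: "0 < \<tau>" "\<tau> < 1 / 2"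
    and V: "3 * (4 * sigma1_sq P Z X h / real n + 2 * sigma2_sq P Z X h / (real n * (real n - 1))
      + sigma_sq P X h / real M) \<le> \<tau> * \<epsilon>\<^sup>2"
    and draws_indep: "\<And>k. k \<in> {1..K} \<Longrightarrow> indep_vars (\<lambda>_. count_space (index_pairs n)) (J k) {1..M}"
    and draws_uniform: "\<And>k m. k \<in> {1..K} \<Longrightarrow> m \<in> {1..M} \<Longrightarrow>
      distr P (count_space (index_pairs n)) (J k m) = uniform_count_measure (index_pairs n)"
    and blocks_indep: "indep_vars (\<lambda>_. \<Pi>\<^sub>M m\<in>{1..M}. count_space (index_pairs n))
      (\<lambda>k \<omega>. \<lambda>m\<in>{1..M}. J k m \<omega>) {1..K}"
    and J_indep_X: "indep_rvs P
      (\<Pi>\<^sub>M k\<in>{1..K}. \<Pi>\<^sub>M m\<in>{1..M}. count_space (index_pairs n)) (\<lambda>\<omega>. \<lambda>k\<in>{1..K}. \<lambda>m\<in>{1..M}. J k m \<omega>)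
      (\<Pi>\<^sub>M i\<in>{1..n}. Z) (\<lambda>\<omega>. \<lambda>i\<in>{1..n}. X i \<omega>)"
  shows "{\<omega> \<in> space P. \<epsilon> < \<bar>MoIU X h K M J \<omega> - theta P X h\<bar>} \<in> events" (is "?bad \<in> _")
    and "prob {\<omega> \<in> space P. \<epsilon> < \<bar>MoIU X h K M J \<omega> - theta P X h\<bar>}
      \<le> exp (- 2 * real K * (1 / 2 - \<tau>)\<^sup>2) + exp (- 8 * real L * \<tau>\<^sup>2 / 9)"
proof -
  let ?I = "index_pairs n" and ?\<theta> = "theta P X h"
  let ?Jf = "\<lambda>\<omega>. \<lambda>k\<in>{1..K}. \<lambda>m\<in>{1..M}. J k m \<omega>" and ?Xf = "\<lambda>\<omega>. \<lambda>i\<in>{1..n}. X i \<omega>"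
  let ?NM = "\<Pi>\<^sub>M m\<in>{1..M}. count_space ?I"
  let ?NK = "\<Pi>\<^sub>M k\<in>{1..K}. ?NM" and ?Q = "\<Pi>\<^sub>M i\<in>{1..n}. Z"
  define S where "S = {1..M} \<rightarrow>\<^sub>E ?I"
  define T where "T = {1..K} \<rightarrow>\<^sub>E S"
  have "(1, 2) \<in> ?I" using n_ge by (simp add: index_pairs_mem)
  then have I: "finite ?I" "?I \<noteq> {}" using finite_index_pairs by auto
  then have S: "finite S" "S \<noteq> {}" by (auto simp: S_def PiE_eq_empty_iff intro!: finite_PiE)
  then have T: "finite T" "T \<noteq> {}" by (auto simp: T_def PiE_eq_empty_iff intro!: finite_PiE)
  have S_mem: "j m \<in> ?I" if "j \<in> S" "m \<in> {1..M}" for j m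
    using that unfolding S_def by (rule PiE_mem)
  have T_mem: "j k \<in> S" if "j \<in> T" "k \<in> {1..K}" for j k
    using that unfolding T_def by (rule PiE_mem)
  have single_S: "{j} \<in> sets ?NM" if "j \<in> S" for j
  proof -
    have "{j} = PiE {1..M} (\<lambda>m. {j m})" using that by (intro PiE_singleton[symmetric]) (simp add: S_def PiE_iff)
    also have "\<dots> \<in> sets ?NM" using S_mem[OF that] by (intro sets_PiM_I_finite) auto
    finally show ?thesis .
  qed
  have single_T: "{j} \<in> sets ?NK" if "j \<in> T" for j
  proof -
    have "{j} = PiE {1..K} (\<lambda>k. {j k})" using that by (intro PiE_singleton[symmetric]) (simp add: T_def PiE_iff)
    also have "\<dots> \<in> sets ?NK" by (intro sets_PiM_I_finite single_S T_mem that) auto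
    finally show ?thesis .
  qed
  have J_meas: "J k m \<in> measurable P (count_space ?I)" if "k \<in> {1..K}" "m \<in> {1..M}" for k m
    using draws_indep[OF that(1)] that(2) unfolding indep_vars_def by blast
  have Jf_T: "?Jf \<omega> \<in> T" if "\<omega> \<in> space P" for \<omega>
    unfolding T_def S_def restrict_PiE_iff
    using measurable_space[OF J_meas that] by (simp add: space_count_space)
  have unif_pair: "prob {\<omega> \<in> space P. J k m \<omega> = a} = 1 / real (card ?I)"
    if "k \<in> {1..K}" "m \<in> {1..M}" "a \<in> ?I" for k m a
  proof -
    have "prob {\<omega> \<in> space P. J k m \<omega> = a} = prob (J k m -` {a} \<inter> space P)"
      by (rule arg_cong[of _ _ prob]) auto
    also have "\<dots> = measure (distr P (count_space ?I) (J k m)) {a}"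
      using that by (intro measure_distr[symmetric] J_meas) auto
    also have "\<dots> = 1 / real (card ?I)"
      unfolding draws_uniform[OF that(1,2)] using that I by (simp add: measure_uniform_count_measure)
    finally show ?thesis .
  qed
  have unif_block: "prob {\<omega> \<in> space P. (\<lambda>m\<in>{1..M}. J k m \<omega>) = j} = 1 / real (card S)"
    if "k \<in> {1..K}" "j \<in> S" for k j
    unfolding S_def
  proof (rule prob_uniform_tuple[OF draws_indep[OF that(1)] _ _ I(1)])
    show "j \<in> {1..M} \<rightarrow>\<^sub>E ?I" using that(2) by (simp add: S_def)
  qed (use M unif_pair that(1) in auto)
  have unif: "prob {\<omega> \<in> space P. ?Jf \<omega> = j} = 1 / real (card T)" if "j \<in> T" for j
    unfolding T_def
  proof (rule prob_uniform_tuple[OF blocks_indep _ _ S(1) single_S unif_block])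
    show "j \<in> {1..K} \<rightarrow>\<^sub>E S" using that by (simp add: T_def)
  qed (use K in auto)
  define mom where "mom j x = sample_median (map (\<lambda>k. block_mean M (j k) x + ?\<theta>) [1..<K + 1])" for j x
  have MoIU_eq: "MoIU X h K M J \<omega> = mom (?Jf \<omega>) (\<lambda>i. X i \<omega>)" for \<omega>
    unfolding MoIU_def mom_def using incomplete_U_eq[OF M]
    by (intro arg_cong[of _ _ sample_median] map_cong refl) auto
  define E where "E j = {x \<in> space ?Q. \<epsilon> < \<bar>mom j x - ?\<theta>\<bar>}" for j
  have mom_restrict: "mom j (restrict x {1..n}) = mom j x" if "j \<in> T" for j x
  proof -
    have "block_mean M (j k) (restrict x {1..n}) = block_mean M (j k) x" if "k \<in> set [1..<K + 1]" for k
    proof -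
      have "k \<in> {1..K}" using that by auto
      from T_mem[OF \<open>j \<in> T\<close> this] show ?thesis unfolding S_def by (rule block_mean_restrict)
    qed
    then show ?thesis unfolding mom_def by (intro arg_cong[of _ _ sample_median] map_cong refl) simp
  qed
  have Xf_space: "?Xf \<omega> \<in> space ?Q" if "\<omega> \<in> space P" for \<omega>
    using that by (simp add: space_PiM restrict_PiE_iff X_space)
  have E_iff: "?Xf \<omega> \<in> E j \<longleftrightarrow> \<epsilon> < \<bar>mom j (\<lambda>i. X i \<omega>) - ?\<theta>\<bar>" if "\<omega> \<in> space P" "j \<in> T" for \<omega> j
    using Xf_space[OF that(1)] mom_restrict[OF that(2)] by (simp add: E_def)
  have E_sets: "E j \<in> sets ?Q" if "j \<in> T" for j
  proof -
    have "(\<lambda>x. block_mean M (j k) x + ?\<theta>) \<in> borel_measurable ?Q" if "k \<in> {1..K}" for k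
    proof -
      have "fst (j k m) \<in> {1..n} \<and> snd (j k m) \<in> {1..n}" if "m \<in> {1..M}" for m
        using S_mem[OF T_mem[OF \<open>j \<in> T\<close> \<open>k \<in> {1..K}\<close>] that] by (simp add: index_pairs_mem)
      then show ?thesis by (intro borel_measurable_add block_mean_meas borel_measurable_const)
    qed
    then have "(\<lambda>x. mom j x) \<in> borel_measurable ?Q"
      unfolding mom_def using K by (intro borel_measurable_sample_median) auto
    then show ?thesis unfolding E_def by measurable
  qed
  have bad_eq: "?bad = {\<omega> \<in> space P. ?Xf \<omega> \<in> E (?Jf \<omega>)}"
    using E_iff Jf_T MoIU_eq by auto
  show "?bad \<in> events"
    unfolding bad_eq by (rule events_mixture[OF J_indep_X T(1) Jf_T single_T E_sets])
  define p where "p \<omega> = (\<Sum>j\<in>S. indicator {\<epsilon><..} \<bar>block_mean M j (\<lambda>i. X i \<omega>)\<bar>) / real (card S)" for \<omega>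
  have p_meas: "p \<in> borel_measurable P"
    unfolding p_def S_def by (rule deviation_fraction_mean_le(2)[OF M \<epsilon> t(1) V])
  have tail: "prob {\<omega> \<in> space P. \<tau> \<le> p \<omega>} \<le> exp (- 8 * real L * \<tau>\<^sup>2 / 9)"
    unfolding p_def S_def by (rule deviation_fraction_tail[OF M L \<epsilon> t(1) V])
  let ?c = "exp (- 2 * real K * (1 / 2 - \<tau>)\<^sup>2)"
  let ?A = "{\<omega> \<in> space P. \<tau> \<le> p \<omega>}"
  have A: "?A \<in> events" using p_meas by measurable
  have pointwise: "(\<Sum>j\<in>T. indicator (E j) (?Xf \<omega>)) / real (card T) \<le> ?c + indicator ?A \<omega>"
    if \<omega>: "\<omega> \<in> space P" for \<omega>
  proof (cases "\<tau> \<le> p \<omega>")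
    case True
    have "(\<Sum>j\<in>T. indicator (E j) (?Xf \<omega>)) \<le> (\<Sum>j\<in>T. 1 :: real)"
      by (intro sum_mono) (simp add: indicator_def)
    also have "\<dots> = real (card T)" by simp
    finally have "(\<Sum>j\<in>T. indicator (E j) (?Xf \<omega>)) / real (card T) \<le> 1"
      using T by (simp add: divide_le_eq_1 card_gt_0_iff)
    then show ?thesis using True \<omega> by (simp add: add_increasing)
  next
    case False
    define B where "B = {j \<in> S. \<epsilon> < \<bar>block_mean M j (\<lambda>i. X i \<omega>)\<bar>}"
    have "p \<omega> = real (card B) / real (card S)"
      using S by (simp add: p_def B_def indicator_def of_bool_def sum.If_cases Int_def)
    with False have pB: "real (card B) / real (card S) \<le> \<tau>" by simp
    define H where "H = {j \<in> T. real (card {1..K}) \<le> 2 * real (card {k \<in> {1..K}. j k \<in> B})}"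
    have EH: "j \<in> H" if j: "j \<in> T" "?Xf \<omega> \<in> E j" for j
    proof -
      let ?xs = "map (\<lambda>k. block_mean M (j k) (\<lambda>i. X i \<omega>) + ?\<theta>) [1..<K + 1]"
      have "\<epsilon> < \<bar>sample_median ?xs - ?\<theta>\<bar>" using E_iff[OF \<omega> j(1)] j(2) by (simp add: mom_def)
      from sample_median_deviation[OF this] K
      have "K \<le> 2 * card {i. i < K \<and> \<epsilon> < \<bar>?xs ! i - ?\<theta>\<bar>}" by simp
      \<comment> \<open>List position \<open>i\<close> holds block \<open>Suc i\<close>, since the
        blocks are numbered from 1.\<close>
      also have "card {i. i < K \<and> \<epsilon> < \<bar>?xs ! i - ?\<theta>\<bar>} = card (Suc ` {i. i < K \<and> \<epsilon> < \<bar>?xs ! i - ?\<theta>\<bar>})"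
        by (simp add: card_image)
      also have "\<dots> \<le> card {k \<in> {1..K}. j k \<in> B}"
      proof (intro card_mono)
        show "Suc ` {i. i < K \<and> \<epsilon> < \<bar>?xs ! i - ?\<theta>\<bar>} \<subseteq> {k \<in> {1..K}. j k \<in> B}"
        proof
          fix k assume "k \<in> Suc ` {i. i < K \<and> \<epsilon> < \<bar>?xs ! i - ?\<theta>\<bar>}"
          then obtain i where i: "k = Suc i" "i < K" "\<epsilon> < \<bar>?xs ! i - ?\<theta>\<bar>" by blast
          then have "?xs ! i = block_mean M (j k) (\<lambda>i. X i \<omega>) + ?\<theta>" by (simp del: upt_Suc)
          moreover have "j k \<in> S" using T_mem[OF j(1), of k] i by simp
          ultimately show "k \<in> {k \<in> {1..K}. j k \<in> B}" using i by (simp add: B_def)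
        qed
      qed simp
      finally show ?thesis using j(1) by (simp add: H_def)
    qed
    have "(\<Sum>j\<in>T. indicator (E j) (?Xf \<omega>)) \<le> (\<Sum>j\<in>T. indicator H j :: real)"
      using EH by (intro sum_mono) (simp add: indicator_def)
    also have "\<dots> = real (card H)"
      using T by (simp add: H_def indicator_def of_bool_def sum.If_cases Int_def)
    finally have "(\<Sum>j\<in>T. indicator (E j) (?Xf \<omega>)) / real (card T) \<le> real (card H) / real (card T)"
      by (intro divide_right_mono) auto
    \<comment> \<open>An array in \<open>T\<close> consists of \<open>K\<close> draws from
      \<open>S\<close>, in which the bad blocks \<open>B\<close> have density at most
      \<tau>.\<close>
    also have "\<dots> \<le> ?c"
      using avg_half_hits_le[of "{1..K}" S B \<tau>] S pB t(2) unfolding H_def T_def by (simp add: B_def)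
    finally show ?thesis by (simp add: add_increasing2)
  qed
  have EX: "{\<omega> \<in> space P. ?Xf \<omega> \<in> E j} \<in> events" if "j \<in> T" for j
    using measurable_sets[OF measurable_select[of "\<lambda>i. i"] E_sets[OF that]]
    by (simp add: vimage_def Int_def conj_commute)
  have iE: "integrable P (\<lambda>\<omega>. indicator (E j) (?Xf \<omega>) :: real)"
    and eE: "expectation (\<lambda>\<omega>. indicator (E j) (?Xf \<omega>)) = prob {\<omega> \<in> space P. ?Xf \<omega> \<in> E j}" if "j \<in> T" for j
  proof -
    have *: "indicator (E j) (?Xf \<omega>) = (indicator {\<omega> \<in> space P. ?Xf \<omega> \<in> E j} \<omega> :: real)"
      if "\<omega> \<in> space P" for \<omega>
      using that by (simp add: indicator_def)
    show "integrable P (\<lambda>\<omega>. indicator (E j) (?Xf \<omega>) :: real)"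
      using EX[OF that]
      by (subst Bochner_Integration.integrable_cong[OF refl *]) (auto intro!: integrable_const_bound[of _ 1])
    show "expectation (\<lambda>\<omega>. indicator (E j) (?Xf \<omega>)) = prob {\<omega> \<in> space P. ?Xf \<omega> \<in> E j}"
      using EX[OF that] by (subst Bochner_Integration.integral_cong[OF refl *]) auto
  qed
  have "prob ?bad = (\<Sum>j\<in>T. prob {\<omega> \<in> space P. ?Jf \<omega> = j} * prob {\<omega> \<in> space P. ?Xf \<omega> \<in> E j})"
    unfolding bad_eq by (rule prob_mixture[OF J_indep_X T(1) Jf_T single_T E_sets])
  also have "\<dots> = (\<Sum>j\<in>T. expectation (\<lambda>\<omega>. indicator (E j) (?Xf \<omega>))) / real (card T)"
    unfolding sum_divide_distrib by (intro sum.cong refl) (simp only: unif eE mult_1 times_divide_eq_left)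
  also have "\<dots> = expectation (\<lambda>\<omega>. (\<Sum>j\<in>T. indicator (E j) (?Xf \<omega>)) / real (card T))"
    using iE by (simp add: Bochner_Integration.integral_sum)
  also have "\<dots> \<le> expectation (\<lambda>\<omega>. ?c + indicator ?A \<omega>)"
    using pointwise A iE
    by (intro integral_mono Bochner_Integration.integrable_add integrable_divide Bochner_Integration.integrable_sum)
      (auto intro!: integrable_const_bound[of _ 1])
  also have "\<dots> = ?c + prob ?A"
  proof -
    have "integrable P (indicator ?A :: _ \<Rightarrow> real)" using A by (intro integrable_const_bound[of _ 1]) auto
    then have "expectation (\<lambda>\<omega>. ?c + indicator ?A \<omega>) = expectation (\<lambda>\<omega>. ?c) + expectation (indicator ?A)"
      by (intro Bochner_Integration.integral_add) auto
    then show ?thesis using A by (simp add: prob_space)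
  qed
  finally show "prob ?bad \<le> ?c + exp (- 8 * real L * \<tau>\<^sup>2 / 9)" using tail by linarith
qed

end

text \<open>Each of the two roundings is paid for by a factor 2. With \<open>y\<close> and
  \<open>z\<close> as in the proof, \<open>M\<close> is the floor of 2 z and is at least 1, so M is
  at least z. Conversely M is at most 2 z, so n / (2 M) is at least 2 y, and its integer part is
  still at least y because y is at least 3.\<close>

lemma block_count_bounds:
  fixes l \<tau> :: real and n M :: nat
  assumes l: "2 / 3 \<le> l" and t: "0 < \<tau>" "\<tau> < 1 / 2" and n: "real n \<ge> 9 * l / (2 * \<tau>\<^sup>2)"
    and M: "0 < M" "int M = \<lfloor>2 * real n * \<tau>\<^sup>2 / (9 * l)\<rfloor>"
  shows "1 / real M \<le> 9 * l / (real n * \<tau>\<^sup>2)"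
    and "9 * l / (8 * \<tau>\<^sup>2) \<le> real (n div (2 * M))" and "0 < n div (2 * M)" and "12 \<le> n"
proof -
  have t2: "0 < \<tau>\<^sup>2" using t by simp
  have "\<tau>\<^sup>2 < (1 / 2)\<^sup>2" using t by (intro power_strict_mono) auto
  then have t4: "\<tau>\<^sup>2 < 1 / 4" by (simp add: power2_eq_square)
  \<comment> \<open>The number of segments at which the exponent 8 L \<tau>^2 / 9 reaches
    \<open>l\<close>.\<close>
  define y where "y = 9 * l / (8 * \<tau>\<^sup>2)"
  have "3 * (8 * \<tau>\<^sup>2) \<le> 9 * l" using t4 l by linarith
  then have y: "3 \<le> y" using t2 by (simp add: y_def pos_le_divide_eq)
  have "4 * y = 9 * l / (2 * \<tau>\<^sup>2)" by (simp add: y_def)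
  with n y have n12: "real n \<ge> 12" by linarith
  then show "12 \<le> n" by simp
  define z where "z = real n * \<tau>\<^sup>2 / (9 * l)"
  have zpos: "z > 0" unfolding z_def using n12 t2 l by (intro divide_pos_pos mult_pos_pos) auto
  have "int M = \<lfloor>2 * z\<rfloor>" using M(2) by (simp add: z_def mult.assoc)
  then have Mz: "real M \<le> 2 * z" "2 * z < real M + 1" by linarith+
  have M1: "1 \<le> real M" using M by simp
  with Mz have "z \<le> real M" by linarith
  then have "1 / real M \<le> 1 / z" using zpos by (intro divide_left_mono) auto
  also have "1 / z = 9 * l / (real n * \<tau>\<^sup>2)" by (simp add: z_def)
  finally show "1 / real M \<le> 9 * l / (real n * \<tau>\<^sup>2)" .
  have "2 * y * (2 * z) = real n / 2" using t2 l by (simp add: y_def z_def)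
  moreover have "2 * y * real M \<le> 2 * y * (2 * z)" using Mz y by (intro mult_left_mono) auto
  ultimately have "2 * y * real (2 * M) \<le> real n" by simp
  then have "2 * y \<le> real n / real (2 * M)" using M by (simp add: pos_le_divide_eq)
  moreover have "real n / real (2 * M) < real (n div (2 * M)) + 1"
    using floor_divide_of_nat_eq[of n "2 * M", where ?'a = real] by linarith
  ultimately have "y \<le> real (n div (2 * M))" using y by linarith
  then show "9 * l / (8 * \<tau>\<^sup>2) \<le> real (n div (2 * M))" by (simp only: y_def)
  with y have "0 < real (n div (2 * M))" unfolding y_def by linarith
  then show "0 < n div (2 * M)" by simp
qed

theorem theorem3p1:
  fixes P :: "'w measure" and Z :: "'z measure"
    and X :: "nat \<Rightarrow> 'w \<Rightarrow> 'z" and h :: "'z \<Rightarrow> 'z \<Rightarrow> real"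
    and J :: "nat \<Rightarrow> nat \<Rightarrow> 'w \<Rightarrow> nat \<times> nat"
    and n K M :: nat and \<delta> \<tau> :: real
  assumes "0 < \<delta>" "\<delta> < 1" and "0 < \<tau>" "\<tau> < 1 / 2"
    and "0 < n" "0 < K" "0 < M"
    and "real n \<ge> 9 * ln (2 / \<delta>) / (2 * \<tau>\<^sup>2)"
    and "real K \<ge> ln (2 / \<delta>) / (2 * (1 / 2 - \<tau>)\<^sup>2)"
    and "int M = \<lfloor>2 * real n * \<tau>\<^sup>2 / (9 * ln (2 / \<delta>))\<rfloor>"
    and "prob_space P"
    and X_indep: "prob_space.indep_vars P (\<lambda>_. Z) X {1..n}"
    and X_ident: "\<And>i. i \<in> {1..n} \<Longrightarrow> distr P Z (X i) = distr P Z (X 1)"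
    and h_meas: "(\<lambda>(x, y). h x y) \<in> borel_measurable (Z \<Otimes>\<^sub>M Z)"
    and h_sym: "\<And>x y. x \<in> space Z \<Longrightarrow> y \<in> space Z \<Longrightarrow> h x y = h y x"
    and h_sq: "integrable P (\<lambda>\<omega>. (h (X 1 \<omega>) (X 2 \<omega>))\<^sup>2)"
    and draws_indep: "\<And>k. k \<in> {1..K} \<Longrightarrow>
      prob_space.indep_vars P (\<lambda>_. count_space (index_pairs n)) (J k) {1..M}"
    and draws_uniform: "\<And>k m. k \<in> {1..K} \<Longrightarrow> m \<in> {1..M} \<Longrightarrow>
      distr P (count_space (index_pairs n)) (J k m) = uniform_count_measure (index_pairs n)"
    and blocks_indep: "prob_space.indep_vars P
      (\<lambda>_. \<Pi>\<^sub>M m\<in>{1..M}. count_space (index_pairs n)) (\<lambda>k \<omega>. \<lambda>m\<in>{1..M}. J k m \<omega>) {1..K}"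
    and J_indep_X: "indep_rvs P
      (\<Pi>\<^sub>M k\<in>{1..K}. \<Pi>\<^sub>M m\<in>{1..M}. count_space (index_pairs n))
      (\<lambda>\<omega>. \<lambda>k\<in>{1..K}. \<lambda>m\<in>{1..M}. J k m \<omega>)
      (\<Pi>\<^sub>M i\<in>{1..n}. Z) (\<lambda>\<omega>. \<lambda>i\<in>{1..n}. X i \<omega>)"
  shows "prob_space.prob P {\<omega> \<in> space P.
      \<bar>MoIU X h K M J \<omega> - theta P X h\<bar> \<le>
        sqrt (12 * sigma1_sq P Z X h / (real n * \<tau>)
          + 6 * sigma2_sq P Z X h / (\<tau> * real n * (real n - 1))
          + 27 * sigma_sq P X h * ln (2 / \<delta>) / (real n * \<tau> ^ 3))}
    \<ge> 1 - \<delta>"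
proof -
  let ?l = "ln (2 / \<delta>)" and ?s1 = "sigma1_sq P Z X h" and ?s2 = "sigma2_sq P Z X h" and ?s = "sigma_sq P X h"
  let ?L = "n div (2 * M)"
  let ?V = "4 * ?s1 / real n + 2 * ?s2 / (real n * (real n - 1)) + ?s / real M"
  define B where "B = 12 * ?s1 / (real n * \<tau>) + 6 * ?s2 / (\<tau> * real n * (real n - 1))
    + 27 * ?s * ?l / (real n * \<tau> ^ 3)"
  interpret prob_space P by fact
  \<comment> \<open>As \<delta> < 1, the logarithm is bounded away from 0; together with \<tau> < 1
    / 2 this forces n to be at least 12.\<close>
  have "ln 2 \<le> ?l" using assms(1,2) by (simp add: pos_le_divide_eq)
  then have l: "2 / 3 \<le> ?l" using ln2_ge_two_thirds by linarith
  note bounds = block_count_bounds[OF l assms(3,4,8,7,10)]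
  interpret iid_kernel P Z X n h
    by unfold_locales (rule X_indep, erule X_ident, rule assms(5), rule h_meas, erule (1) h_sym,
        rule h_sq, use bounds(4) in linarith)
  \<comment> \<open>\<open>sigma2_sq\<close> is defined as a difference, so the sign of
    \<open>?V\<close> is read off from the expectation of an average of squares that it
    bounds.\<close>
  have "0 \<le> expectation (\<lambda>\<omega>. (\<Sum>j\<in>{1..M} \<rightarrow>\<^sub>E index_pairs n. ((\<Sum>m\<in>{1..M}. gp (j m) \<omega>) / real M)\<^sup>2)
      / real (card ({1..M} \<rightarrow>\<^sub>E index_pairs n)))"
    by (intro integral_nonneg_AE AE_I2 divide_nonneg_nonneg sum_nonneg) auto
  also have "\<dots> \<le> ?V" by (rule avg_block_variance(2)[OF assms(7)])
  finally have V0: "0 \<le> ?V" .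
  have s0: "0 \<le> ?s" unfolding sigma_sq_def by (intro integral_nonneg_AE) auto
  have n: "real n > 0" "real n - 1 > 0" using bounds(4) by auto
  \<comment> \<open>\<open>\<tau> * B\<close> is \<open>3 * ?V\<close> with 1 / M replaced by its
    bound 9 ln (2 / \<delta>) / (n \<tau>^2); this is the origin of the constants 12, 6 and
    27.\<close>
  have VB: "3 * ?V \<le> \<tau> * B"
  proof -
    have "3 * (?s * (1 / real M)) \<le> 3 * (?s * (9 * ?l / (real n * \<tau>\<^sup>2)))"
      using s0 bounds(1) by (intro mult_left_mono) auto
    moreover have "\<tau> * B = 12 * ?s1 / real n + 6 * ?s2 / (real n * (real n - 1))
        + 3 * (?s * (9 * ?l / (real n * \<tau>\<^sup>2)))"
      using assms(3) n by (simp add: B_def distrib_left power2_eq_square power3_eq_cube)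
    ultimately show ?thesis by simp
  qed
  have "0 \<le> \<tau> * B" by (rule order_trans[OF mult_nonneg_nonneg[OF _ V0] VB]) simp
  then have B0: "0 \<le> B" using assms(3) by (simp add: zero_le_mult_iff)
  have dev: "{\<omega> \<in> space P. sqrt B < \<bar>MoIU X h K M J \<omega> - theta P X h\<bar>} \<in> events"
    "prob {\<omega> \<in> space P. sqrt B < \<bar>MoIU X h K M J \<omega> - theta P X h\<bar>}
      \<le> exp (- 2 * real K * (1 / 2 - \<tau>)\<^sup>2) + exp (- 8 * real ?L * \<tau>\<^sup>2 / 9)"
    using VB B0 by (intro MoIU_deviation_prob[OF assms(6,7) bounds(3) _ _ assms(3,4) _
        draws_indep draws_uniform blocks_indep J_indep_X]; simp)+
  have "exp (- ?l) = \<delta> / 2" using assms(1) by (simp add: exp_minus)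
  moreover have "?l \<le> 2 * real K * (1 / 2 - \<tau>)\<^sup>2"
    using assms(4,9) by (simp add: pos_divide_le_eq mult_ac)
  moreover have "?l \<le> 8 * real ?L * \<tau>\<^sup>2 / 9"
    using bounds(2) assms(3) by (simp add: pos_divide_le_eq mult_ac)
  ultimately have "prob {\<omega> \<in> space P. sqrt B < \<bar>MoIU X h K M J \<omega> - theta P X h\<bar>} \<le> \<delta>"
    using dev(2) exp_le_cancel_iff[of "- 2 * real K * (1 / 2 - \<tau>)\<^sup>2" "- ?l"]
      exp_le_cancel_iff[of "- 8 * real ?L * \<tau>\<^sup>2 / 9" "- ?l"] by linarith
  moreover have "{\<omega> \<in> space P. \<bar>MoIU X h K M J \<omega> - theta P X h\<bar> \<le> sqrt B}
      = space P - {\<omega> \<in> space P. sqrt B < \<bar>MoIU X h K M J \<omega> - theta P X h\<bar>}"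
    by auto
  ultimately have "1 - \<delta> \<le> prob {\<omega> \<in> space P. \<bar>MoIU X h K M J \<omega> - theta P X h\<bar> \<le> sqrt B}"
    using prob_compl[OF dev(1)] by simp
  then show ?thesis unfolding B_def .
qed

end
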